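(* The following inclusions hold and all of them are strict: \[ \mathcal{F}_{\mathrm{rr}}^{0}\subsetneq\mathcal{F}_{\mathrm{rr}}\subsetneq\mathcal{F}_{\mathrm{dist}}\subsetneq\mathcal{F}. \]
   Context: $\mathcal{F}$ is the set of rational functions $F(w)=wP(w)/Q(w)$, where $P,Q\in\mathbb{R}[w]$ are relatively prime polynomials with $P(0)=Q(0)=1$. For $F\in\mathcal{F}$ let $D(z)=z\sum_{n\ge0}s_n(F)z^n$ be the compositional inverse of $F$ near $0$ (so $F(D(z))=z$, $D(0)=0$, $s_0(F)=1$). $\mathcal{F}_{\mathrm{dist}}$ is the set of $F\in\mathcal{F}$ such that $(s_n(F))_{n\ge0}$ is positive definite, i.e. there is a probability distribution $\mu$ on $\mathbb{R}$ with $s_n(F)=\int_{\mathbb{R}}x^n\,\mu(dx)$ for all $n\ge 0$. $\mathcal{N}(F)$ is the set of all $z_0\in\mathbb{C}$ such that the polynomial $wP(w)-z_0Q(w)$ (in $w$) has a multiple root $w_0\in\mathbb{C}$; equivalently $F(w_0)=z_0$ and $F'(w_0)=0$ for some $w_0\in\mathbb{C}$. $\mathcal{F}_{\mathrm{rr}}$ is the set of $F\in\mathcal{F}$ with $\mathcal{N}(F)\subseteq\mathbb{R}$. The characteristic polynomial of $F$ is $\chi_F(w)=\big(P(w)+wP'(w)\big)Q(w)-wP(w)Q'(w)$. $\mathcal{F}_{\mathrm{rr}}^{0}$ is the set of $F\in\mathcal{F}$ such that all complex roots of $\chi_F$ are real. *)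

theory Defs
  imports
    "HOL-Computational_Algebra.Computational_Algebra"
    "HOL-Computational_Algebra.Field_as_Ring"
    "HOL-Probability.Probability"
begin

text \<open>
  Rational functions are elements of the fraction field of \<^typ>\<open>real poly\<close>.
  The predicate \<open>represents F P Q\<close> says that \<open>F = w P(w) / Q(w)\<close> in the normalised form;
  \<open>P\<close> and \<open>Q\<close> are then determined by \<open>F\<close> (lemma \<open>represents_unique\<close>), so the choice in
  \<open>numP\<close> and \<open>denQ\<close> is canonical. Outside \<open>ratF\<close> these two functions, and everything defined
  from them, are unspecified and never used.
\<close>

definition represents :: "real poly fract \<Rightarrow> real poly \<Rightarrow> real poly \<Rightarrow> bool" where
  "represents F P Q \<longleftrightarrow>
     coprime P Q \<and> poly P 0 = 1 \<and> poly Q 0 = 1 \<and> F = Fract ([:0, 1:] * P) Q"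

definition ratF :: "real poly fract set" where
  "ratF = {F. \<exists>P Q. represents F P Q}"

definition numP :: "real poly fract \<Rightarrow> real poly" where
  "numP F = (THE P. \<exists>Q. represents F P Q)"

definition denQ :: "real poly fract \<Rightarrow> real poly" where
  "denQ F = (THE Q. \<exists>P. represents F P Q)"

lemma represents_unique:
  assumes "represents F P Q" "represents F P' Q'"
  shows "P = P' \<and> Q = Q'"
proof -
  from assms have cop: "coprime P Q" "coprime P' Q'"
    and one: "poly P 0 = 1" "poly Q 0 = 1" "poly P' 0 = 1" "poly Q' 0 = 1"
    and eq: "Fract ([:0, 1:] * P) Q = Fract ([:0, 1:] * P') Q'"
    by (auto simp: represents_def)
  have nz: "P \<noteq> 0" "P' \<noteq> 0" "Q \<noteq> 0" "Q' \<noteq> 0" using one by auto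
  have "[:0, 1:] * (P * Q') = [:0, 1:] * (P' * Q)"
    using eq nz by (simp add: eq_fract mult_ac)
  then have cross: "P * Q' = P' * Q" by simp
  have "Q dvd P * Q'" "Q' dvd P' * Q"
    by (simp add: cross, simp flip: cross)
  then have "Q dvd Q'" "Q' dvd Q"
    using cop[THEN coprime_commute[THEN iffD1]] by (simp_all only: coprime_dvd_mult_right_iff)
  then obtain u v where uv: "Q' = Q * u" "Q = Q' * v" by (elim dvdE)
  then have "Q * (u * v) = Q * 1" by (metis mult.assoc mult_1_right)
  then have "u * v = 1" using nz mult_left_cancel by blast
  then have "u dvd 1" by (metis dvd_triv_left)
  then obtain c where c: "u = [:c:]" by (auto simp: is_unit_poly_iff)
  then have "c = 1" using one uv(1) by simp
  then have "Q' = Q" using uv(1) c by simp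
  with cross nz show ?thesis by simp
qed

lemma
  assumes "represents F P Q"
  shows numP_eq: "numP F = P" and denQ_eq: "denQ F = Q"
  using assms represents_unique unfolding numP_def denQ_def by (blast intro: the_equality)+

lemma represents_numP_denQ: "F \<in> ratF \<Longrightarrow> represents F (numP F) (denQ F)"
  unfolding ratF_def using numP_eq denQ_eq by auto


definition fpsF :: "real poly fract \<Rightarrow> real fps" where
  "fpsF F = fps_X * fps_of_poly (numP F) / fps_of_poly (denQ F)"

definition invD :: "real poly fract \<Rightarrow> real fps" where
  "invD F = fps_inv (fpsF F)"

text \<open>\<open>D(z) = z (s\<^sub>0 + s\<^sub>1 z + \<dots>)\<close>, hence the index shift.\<close>

definition sF :: "real poly fract \<Rightarrow> nat \<Rightarrow> real" where
  "sF F n = fps_nth (invD F) (Suc n)"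

lemma fpsF_props:
  assumes "F \<in> ratF"
  shows "fpsF F * fps_of_poly (denQ F) = fps_X * fps_of_poly (numP F)"
    and "fps_nth (fpsF F) 0 = 0" and "fps_nth (fpsF F) 1 = 1"
proof -
  have one: "coeff (numP F) 0 = 1" "coeff (denQ F) 0 = 1"
    using represents_numP_denQ[OF assms] by (auto simp: represents_def poly_0_coeff_0)
  then have u: "fps_nth (fps_of_poly (denQ F)) 0 \<noteq> 0" by simp
  have eq: "fpsF F = fps_X * fps_of_poly (numP F) * inverse (fps_of_poly (denQ F))"
    unfolding fpsF_def by (rule fps_divide_unit[OF u])
  show "fpsF F * fps_of_poly (denQ F) = fps_X * fps_of_poly (numP F)"
    unfolding eq by (simp add: mult.assoc inverse_mult_eq_1[OF u])
  show "fps_nth (fpsF F) 0 = 0" "fps_nth (fpsF F) 1 = 1"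
    unfolding eq using one by (simp_all add: mult.assoc)
qed

lemma invD_props:
  assumes "F \<in> ratF"
  shows "fpsF F oo invD F = fps_X" "fps_nth (invD F) 0 = 0" "sF F 0 = 1"
proof -
  have f: "fps_nth (fpsF F) 0 = 0" "fps_nth (fpsF F) 1 \<noteq> 0" "fps_nth (fpsF F) 1 = 1"
    using fpsF_props[OF assms] by auto
  show "fpsF F oo invD F = fps_X"
    unfolding invD_def by (rule fps_inv_right[OF f(1,2)])
  show "fps_nth (invD F) 0 = 0" "sF F 0 = 1"
    using f by (simp_all add: invD_def sF_def fps_inv_def)
qed


definition moment_sequence :: "(nat \<Rightarrow> real) \<Rightarrow> bool" where
  "moment_sequence s \<longleftrightarrow>
     (\<exists>M :: real measure. real_distribution M \<and>
        (\<forall>n. integrable M (\<lambda>x. x ^ n) \<and> s n = (\<integral>x. x ^ n \<partial>M)))"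

definition ratF_dist :: "real poly fract set" where
  "ratF_dist = {F \<in> ratF. moment_sequence (sF F)}"


abbreviation cpoly :: "real poly \<Rightarrow> complex poly" where
  "cpoly \<equiv> map_poly complex_of_real"

text \<open>
  The polynomial \<open>w P(w) - z\<^sub>0 Q(w)\<close> is never zero, because \<open>P(0) = Q(0) = 1\<close>, so
  \<^const>\<open>order\<close> is the genuine multiplicity of the root.
\<close>

definition critN :: "real poly fract \<Rightarrow> complex set" where
  "critN F = {z0. \<exists>w0. order w0 ([:0, 1:] * cpoly (numP F) - smult z0 (cpoly (denQ F))) \<ge> 2}"

definition ratF_rr :: "real poly fract set" where
  "ratF_rr = {F \<in> ratF. critN F \<subseteq> \<real>}"

definition chiF :: "real poly fract \<Rightarrow> real poly" where
  "chiF F = (numP F + [:0, 1:] * pderiv (numP F)) * denQ F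
              - [:0, 1:] * numP F * pderiv (denQ F)"

definition ratF_rr0 :: "real poly fract set" where
  "ratF_rr0 = {F \<in> ratF. \<forall>w :: complex. poly (cpoly (chiF F)) w = 0 \<longrightarrow> w \<in> \<real>}"

end

theory Submission
  imports Defs "HOL-Complex_Analysis.Complex_Analysis"
begin

text \<open>
  Let \<open>H\<close> be the upper half-plane. If the critical values of \<open>F\<close> are real, then \<open>F\<close> restricted to
  \<open>F\<^sup>-\<^sup>1(H)\<close> is a finite covering of \<open>H\<close>; as \<open>H\<close> is simply connected, the inverse series \<open>D\<close>
  continues to a holomorphic section \<open>g\<close> of \<open>F\<close> on \<open>H\<close>. Since \<open>F\<close> is real on the real line, \<open>g\<close>
  takes no real values, so \<open>g\<close> maps \<open>H\<close> to itself. Then \<open>G(u) = g(1/u)\<close> on the lower half-plane is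
  the Cauchy transform of a compactly supported measure, which is a weak limit of the densities
  \<open>Im G(x - i\<epsilon>) / \<pi>\<close> for \<open>\<epsilon> \<rightarrow> 0\<close>; its moments are the coefficients of \<open>D\<close>.

  The inclusion \<open>ratF_rr \<subseteq> ratF_dist\<close> is strict because only the critical values met by the branch \<open>D\<close>
  matter: for \<open>F = F\<^sub>1 \<circ> F\<^sub>2\<close> with \<open>F\<^sub>1(t) = t / (1 + t\<^sup>2)\<close> and \<open>F\<^sub>2(w) = w / (1 - w\<^sup>2 / 16)\<close>, the
  inverse of \<open>F\<^sub>1\<close> maps \<open>H\<close> into the unit disc, while the critical values \<open>\<plusminus>2i\<close> of \<open>F\<^sub>2\<close> lie outside it.
\<close>

section \<open>Stieltjes inversion for Pick functions analytic at infinity\<close>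

abbreviation fps_cplx :: "real fps \<Rightarrow> complex fps" where
  "fps_cplx f \<equiv> Abs_fps (\<lambda>n. complex_of_real (fps_nth f n))"

text \<open>Integration shifts the coefficients and divides them by positive integers, so at a
  positive \<open>r\<close> below the radius of \<open>f\<close> the new terms are dominated by
  \<open>r\<close> times those of the absolutely convergent series of \<open>f\<close>.\<close>

lemma fps_conv_radius_integral_ge:
  fixes f :: "complex fps"
  shows "fps_conv_radius (fps_integral0 f) \<ge> fps_conv_radius f"
  unfolding fps_conv_radius_def
proof (rule conv_radius_geI_ex)
  fix r :: real assume r: "r > 0" "ereal r < conv_radius (fps_nth f)"
  have "summable (\<lambda>n. norm (fps_nth f n * of_real r ^ n))"
    using r by (intro abs_summable_in_conv_radius) auto
  then have "summable (\<lambda>n. r * norm (fps_nth f n * of_real r ^ n))"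
    by (rule summable_mult)
  then have "summable (\<lambda>n. fps_nth (fps_integral0 f) (Suc n) * of_real r ^ Suc n)"
  proof (rule summable_comparison_test'[where N = 0])
    fix n :: nat
    have "norm (fps_nth f n) * r ^ Suc n / real (Suc n) \<le> norm (fps_nth f n) * r ^ Suc n / 1"
      using r by (intro divide_left_mono) auto
    then show "norm (fps_nth (fps_integral0 f) (Suc n) * of_real r ^ Suc n)
        \<le> r * norm (fps_nth f n * of_real r ^ n)"
      using r by (simp add: fps_integral_def norm_mult norm_power norm_divide norm_inverse field_simps
          del: of_nat_Suc)
  qed
  then show "\<exists>z. norm z = r \<and> summable (\<lambda>n. fps_nth (fps_integral0 f) n * z ^ n)"
    using r summable_Suc_iff[of "\<lambda>n. fps_nth (fps_integral0 f) n * of_real r ^ n"]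
    by (intro exI[of _ "of_real r"]) (auto simp del: power_Suc)
qed

lemma eval_fps_real_coeffs_in_Reals:
  fixes f :: "complex fps"
  assumes "\<And>n. fps_nth f n \<in> \<real>" "norm x < fps_conv_radius f" "x \<in> \<real>"
  shows "eval_fps f x \<in> \<real>"
proof -
  have "(\<lambda>n. fps_nth f n * x ^ n) sums eval_fps f x"
    using assms(2) by (rule sums_eval_fps)
  then have "(\<lambda>n. Im (fps_nth f n * x ^ n)) sums Im (eval_fps f x)"
    by (rule sums_Im)
  moreover have "Im (fps_nth f n * x ^ n) = 0" for n
    using assms(1)[of n] assms(3) by (metis Reals_mult Reals_power complex_is_Real_iff)
  ultimately have "Im (eval_fps f x) = 0"
    by (simp add: sums_iff)
  then show ?thesis by (simp add: complex_is_Real_iff)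
qed

lemma eval_fps_split:
  fixes f :: "complex fps"
  assumes "norm z < fps_conv_radius f"
  shows "eval_fps f z = (\<Sum>k<m. fps_nth f k * z ^ k) + z ^ m * eval_fps (fps_shift m f) z"
proof -
  have "(\<lambda>n. fps_nth f n * z ^ n) sums eval_fps f z"
    using assms by (rule sums_eval_fps)
  then have "(\<lambda>n. fps_nth f (n + m) * z ^ (n + m)) sums
      (eval_fps f z - (\<Sum>k<m. fps_nth f k * z ^ k))"
    using sums_iff_shift[of "\<lambda>n. fps_nth f n * z ^ n" m] by simp
  moreover have "(\<lambda>n. z ^ m * (fps_nth (fps_shift m f) n * z ^ n)) sums
      (z ^ m * eval_fps (fps_shift m f) z)"
    using assms by (intro sums_mult sums_eval_fps) simp
  ultimately show ?thesis
    by (simp add: power_add mult_ac sums_iff algebra_simps)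
qed

text \<open>
  \<open>Ln (\<i> u)\<close> is the primitive of \<open>1/u\<close> whose branch cut avoids the closed lower half-plane, so that
  the primitive stays continuous up to real \<open>u \<noteq> 0\<close> from below.
\<close>
lemma laurent_primitive:
  fixes d :: "complex fps" and n :: nat
  defines "\<Psi> \<equiv> eval_fps (fps_integral0 (fps_shift (n + 2) d))"
  defines "Hn \<equiv> (\<lambda>u. (\<Sum>k<n. fps_nth d (Suc k) * u ^ (n - k) / of_nat (n - k))
                 + fps_nth d (Suc n) * Ln (\<i> * u) - \<Psi> (inverse u))"
  assumes u: "u \<noteq> 0" "norm (inverse u) < fps_conv_radius d" "\<i> * u \<notin> \<real>\<^sub>\<le>\<^sub>0"
    and d0: "fps_nth d 0 = 0"
  shows "(Hn has_field_derivative u ^ n * eval_fps d (inverse u)) (at u)"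
proof -
  let ?E = "fps_shift (n + 2) d" and ?z = "inverse u"
  have rad: "norm ?z < fps_conv_radius (fps_integral0 ?E)"
    using u(2) fps_conv_radius_integral_ge[of ?E] by (simp add: less_le_trans)
  have 1: "((\<lambda>u. \<Psi> (inverse u)) has_field_derivative
      eval_fps ?E ?z * (- (?z ^ 2))) (at u)"
  proof -
    have "(\<Psi> has_field_derivative eval_fps (fps_deriv (fps_integral0 ?E)) ?z) (at ?z)"
      unfolding \<Psi>_def by (rule has_field_derivative_eval_fps[OF rad])
    then have "(\<Psi> has_field_derivative eval_fps ?E ?z) (at ?z)"
      by (simp add: fps_deriv_fps_integral)
    then show ?thesis
      by (rule DERIV_chain2) (use u in \<open>auto intro!: derivative_eq_intros simp: power2_eq_square\<close>)
  qed
  have 2: "(Hn has_field_derivative (\<Sum>k<n. fps_nth d (Suc k) * u ^ (n - Suc k))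
      + fps_nth d (Suc n) * ?z - eval_fps ?E ?z * (- (?z ^ 2))) (at u)"
    unfolding Hn_def
  proof (intro DERIV_add DERIV_diff 1 DERIV_sum)
    show "((\<lambda>u. fps_nth d (Suc n) * Ln (\<i> * u)) has_field_derivative fps_nth d (Suc n) * ?z) (at u)"
      using u by (auto intro!: derivative_eq_intros simp: field_simps)
    fix k assume "k \<in> {..<n}"
    then have "of_nat (n - k) \<noteq> (0::complex)" "n - Suc k = n - k - 1" by auto
    then show "((\<lambda>u. fps_nth d (Suc k) * u ^ (n - k) / of_nat (n - k)) has_field_derivative
       fps_nth d (Suc k) * u ^ (n - Suc k)) (at u)"
      by (auto intro!: derivative_eq_intros)
  qed
  \<comment> \<open>The exponent of \<open>u\<close> is \<open>n - k - 1\<close>: nonnegative powers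
    for \<open>k < n\<close>, the term \<open>1/u\<close> behind the logarithm for
    \<open>k = n\<close>, and the tail beyond.\<close>
  have 3: "u ^ n * ?z ^ Suc k = (if k < n then u ^ (n - Suc k) else if k = n then ?z else ?z ^ (Suc k - n))" 
    for k
  proof -
    consider "k < n" | "k = n" | "k > n" by linarith
    then show ?thesis
    proof cases
      case 1
      then have "u ^ n = u ^ (n - Suc k) * u ^ Suc k" by (simp del: power_Suc flip: power_add)
      with u(1) 1 show ?thesis by (simp add: field_simps)
    next
      case 3
      then have "?z ^ Suc k = ?z ^ (Suc k - n) * ?z ^ n" by (simp del: power_Suc flip: power_add)
      with u(1) 3 show ?thesis by (simp add: field_simps)
    qed (use u in \<open>simp add: field_simps\<close>)
  qed
  have "eval_fps d ?z = (\<Sum>k<n+2. fps_nth d k * ?z ^ k) + ?z ^ (n+2) * eval_fps ?E ?z"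
    by (rule eval_fps_split[OF u(2)])
  also have "(\<Sum>k<n+2. fps_nth d k * ?z ^ k) = (\<Sum>k<Suc n. fps_nth d (Suc k) * ?z ^ Suc k)"
    using d0 by (simp add: sum.lessThan_Suc_shift del: sum.lessThan_Suc power_Suc)
  finally have "u ^ n * eval_fps d ?z = (\<Sum>k<Suc n. fps_nth d (Suc k) * (u ^ n * ?z ^ Suc k))
      + (u ^ n * ?z ^ Suc (Suc n)) * eval_fps ?E ?z"
    by (simp add: algebra_simps sum_distrib_left del: sum.lessThan_Suc)
  also have "(\<Sum>k<Suc n. fps_nth d (Suc k) * (u ^ n * ?z ^ Suc k)) =
      (\<Sum>k<n. fps_nth d (Suc k) * u ^ (n - Suc k)) + fps_nth d (Suc n) * ?z"
    unfolding 3 by simp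
  also have "u ^ n * ?z ^ Suc (Suc n) = ?z ^ 2"
    unfolding 3 by (simp add: power2_eq_square numeral_2_eq_2 Suc_diff_le)
  finally show ?thesis using 2 by (simp add: mult_ac)
qed

text \<open>The integral over the segment at height \<open>-e\<close> is an increment of a primitive
  of \<open>u ^ n * G u\<close>. Both end points lie where the expansion of \<open>G\<close> at
  infinity holds, so the increment can be computed with the Laurent primitive. As \<open>e\<close>
  tends to \<open>0\<close>, its terms become real except for the logarithm, whose imaginary part
  grows by \<open>pi\<close> from \<open>-R\<close> to \<open>R\<close>.\<close>

lemma moment_integral_tendsto:
  fixes d :: "complex fps" and G :: "complex \<Rightarrow> complex"
  assumes hol: "G holomorphic_on {u. Im u < 0}"
    and r: "0 < r" "ereal r \<le> fps_conv_radius d" and R: "inverse r < R"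
    and real: "\<And>n. fps_nth d n \<in> \<real>" and d0: "fps_nth d 0 = 0"
    and G: "\<And>u. Im u < 0 \<Longrightarrow> norm (inverse u) < r \<Longrightarrow> G u = eval_fps d (inverse u)"
  shows "((\<lambda>e. Im (\<integral>x. indicator {-R..R} x *\<^sub>R (Complex x (-e) ^ n * G (Complex x (-e))) \<partial>lborel))
           \<longlongrightarrow> pi * Re (fps_nth d (Suc n))) (at_right 0)"
proof -
  have R0: "R > 0" "inverse R < r"
    using r R less_trans[of 0 "inverse r" R] less_imp_inverse_less[of "inverse r" R] by auto
  define \<Psi> where "\<Psi> = eval_fps (fps_integral0 (fps_shift (n + 2) d))"
  define Hn where "Hn = (\<lambda>u. (\<Sum>k<n. fps_nth d (Suc k) * u ^ (n - k) / of_nat (n - k))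
                 + fps_nth d (Suc n) * Ln (\<i> * u) - \<Psi> (inverse u))"
  have Hn: "(Hn has_field_derivative u ^ n * eval_fps d (inverse u)) (at u)"
    if "u \<noteq> 0" "norm (inverse u) < r" "\<i> * u \<notin> \<real>\<^sub>\<le>\<^sub>0" for u
    unfolding Hn_def \<Psi>_def
  proof (rule laurent_primitive)
    have "ereal (norm (inverse u)) < ereal r" using that by simp
    then show "ereal (norm (inverse u)) < fps_conv_radius d" using r(2) by (rule less_le_trans)
  qed (use that d0 in auto)
  \<comment> \<open>Convexity gives a primitive \<open>K\<close> on the whole half-plane, whereas
    \<open>Hn\<close> is a primitive only where the expansion at infinity is valid.\<close>
  have "(\<lambda>u. u ^ n * G u) holomorphic_on {u. Im u < 0}"
    by (intro holomorphic_intros hol)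
  then obtain K where K0: "\<And>u. u \<in> {u. Im u < 0} \<Longrightarrow>
      (K has_field_derivative u ^ n * G u) (at u within {u. Im u < 0})"
    using holomorphic_convex_primitive'[OF convex_halfspace_Im_lt[of 0] open_halfspace_Im_lt[of 0]]
    by blast
  have K: "(K has_field_derivative u ^ n * G u) (at u)" if "Im u < 0" for u
    using K0[of u] that at_within_open[OF _ open_halfspace_Im_lt[of 0], of u] by simp
  define V where "V = {u. Im u < 0 \<and> norm (inverse u) < r}"
  have Im_inverse: "Im (inverse u) > 0 \<longleftrightarrow> Im u < 0" for u
  proof (cases "u = 0")
    case False
    then have "0 < (Re u)\<^sup>2 + (Im u)\<^sup>2"
      by (simp add: complex_neq_0)
    then show ?thesis by (simp add: divide_less_0_iff not_less_iff_gr_or_eq)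
  qed auto
  \<comment> \<open>Inversion turns the region into a half-disc, whose convexity gives the
    connectedness needed to compare the two primitives.\<close>
  have V: "V = inverse ` ({z. Im z > 0} \<inter> ball 0 r)"
  proof (intro equalityI subsetI)
    fix u assume "u \<in> V"
    then have "u = inverse (inverse u)" "inverse u \<in> {z. Im z > 0} \<inter> ball 0 r"
      by (auto simp: V_def Im_inverse simp del: inverse_complex.simps)
    then show "u \<in> inverse ` ({z. Im z > 0} \<inter> ball 0 r)" by blast
  next
    fix u assume "u \<in> inverse ` ({z. Im z > 0} \<inter> ball 0 r)"
    then obtain z where "u = inverse z" "Im z > 0" "norm z < r" by auto
    then show "u \<in> V" using Im_inverse[of u]
      by (simp add: V_def del: inverse_complex.simps)
  qed
  have "connected V"
    unfolding V
  proof (intro connected_continuous_image convex_connected convex_Int convex_ball convex_halfspace_Im_gt)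
    show "continuous_on ({z. Im z > 0} \<inter> ball 0 r) (inverse :: complex \<Rightarrow> complex)"
      by (intro continuous_intros) auto
  qed
  have "open V"
  proof -
    have "V = {u. Im u < 0} \<inter> {u. 1 < r * norm u}"
    proof -
      have "norm (inverse u) < r \<longleftrightarrow> 1 < r * norm u" if "Im u < 0" for u
        unfolding norm_inverse using that by (cases "u = 0") (auto simp: inverse_eq_divide divide_less_eq)
      then show ?thesis by (auto simp: V_def)
    qed
    then show ?thesis
      by (auto intro!: open_Int open_halfspace_Im_lt open_Collect_less continuous_intros)
  qed
  have "\<exists>c. \<forall>u\<in>V. K u - Hn u = c"
  proof (rule DERIV_zero_connected_constant[where K = "{}", OF \<open>connected V\<close> \<open>open V\<close>, simplified])
    have deriv: "((\<lambda>u. K u - Hn u) has_field_derivative 0) (at u)" if "u \<in> V" for u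
    proof -
      have "u \<noteq> 0" "\<i> * u \<notin> \<real>\<^sub>\<le>\<^sub>0" "Im u < 0" "norm (inverse u) < r"
        using that by (auto simp: V_def complex_nonpos_Reals_iff)
      then show ?thesis
        using DERIV_diff[OF K[of u] Hn[of u]] G[of u] by simp
    qed
    then show "continuous_on V (\<lambda>u. K u - Hn u)"
      by (meson DERIV_isCont continuous_at_imp_continuous_on)
    show "\<forall>u\<in>V. ((\<lambda>u. K u - Hn u) has_field_derivative 0) (at u)"
      using deriv by blast
  qed blast
  then obtain c where c: "\<And>u. u \<in> V \<Longrightarrow> K u - Hn u = c" by blast
  have mV: "Complex x (-e) \<in> V" if "\<bar>x\<bar> = R" "e > 0" for x e
  proof -
    have "R \<le> norm (Complex x (-e))"
      using that abs_Re_le_cmod[of "Complex x (-e)"] by simp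
    then have "norm (inverse (Complex x (-e))) \<le> inverse R"
      using R0 by (simp add: norm_inverse le_imp_inverse_le)
    with R0 that show ?thesis by (auto simp: V_def)
  qed
  have int: "(\<integral>x. indicator {-R..R} x *\<^sub>R (Complex x (-e) ^ n * G (Complex x (-e))) \<partial>lborel)
      = Hn (Complex R (-e)) - Hn (Complex (-R) (-e))" if e: "e > 0" for e
  proof -
    have "(\<integral>x. indicator {-R..R} x *\<^sub>R (Complex x (-e) ^ n * G (Complex x (-e))) \<partial>lborel)
       = K (Complex R (-e)) - K (Complex (-R) (-e))"
    proof (rule integral_FTC_atLeastAtMost)
      show "- R \<le> R" using R0 by simp
      fix x :: real
      have "((\<lambda>x. Complex x (-e)) has_vector_derivative 1) (at x within {-R..R})"
        unfolding Complex_eq by (auto intro!: derivative_eq_intros)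
      moreover have "(K has_field_derivative Complex x (-e) ^ n * G (Complex x (-e)))
          (at (Complex x (-e)) within (\<lambda>x. Complex x (-e)) ` {-R..R})"
        using K[of "Complex x (-e)"] e by (simp add: has_field_derivative_at_within)
      ultimately show "((\<lambda>x. K (Complex x (-e))) has_vector_derivative
           Complex x (-e) ^ n * G (Complex x (-e))) (at x within {-R..R})"
        using field_vector_diff_chain_within[of "\<lambda>x. Complex x (-e)"] by (force simp: o_def)
    next
      have "continuous_on {-R..R} (\<lambda>x. Complex x (-e))"
        unfolding Complex_eq by (intro continuous_intros)
      moreover have "continuous_on {u. Im u < 0} G"
        using hol by (rule holomorphic_on_imp_continuous_on)
      ultimately show "continuous_on {-R..R} (\<lambda>x. Complex x (-e) ^ n * G (Complex x (-e)))"
        using e by (intro continuous_on_mult continuous_on_power) (auto elim!: continuous_on_compose2)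
    qed
    also have "\<dots> = Hn (Complex R (-e)) - Hn (Complex (-R) (-e))"
      using c[OF mV[of R e]] c[OF mV[of "-R" e]] R0 e by (simp add: algebra_simps)
    finally show ?thesis .
  qed
  have cont: "((\<lambda>e. Hn (Complex x (-e))) \<longlongrightarrow> Hn (of_real x)) (at_right 0)" if "\<bar>x\<bar> = R" for x
  proof -
    have "(Hn has_field_derivative of_real x ^ n * eval_fps d (inverse (of_real x))) (at (of_real x))"
      using R0 that by (intro Hn) (auto simp: norm_inverse complex_nonpos_Reals_iff)
    then have "isCont Hn (of_real x)" by (rule DERIV_isCont)
    moreover have "((\<lambda>e. Complex x (-e)) \<longlongrightarrow> of_real x) (at_right 0)"
      unfolding Complex_eq by (auto intro!: tendsto_eq_intros)
    ultimately show ?thesis by (rule isCont_tendsto_compose)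
  qed
  have Psi: "\<Psi> (inverse (of_real x)) \<in> \<real>" if "\<bar>x\<bar> = R" for x
    unfolding \<Psi>_def
  proof (rule eval_fps_real_coeffs_in_Reals)
    show "fps_nth (fps_integral0 (fps_shift (n + 2) d)) m \<in> \<real>" for m
      using real by (simp add: fps_integral_def)
    have "ereal (norm (inverse (complex_of_real x))) < ereal r"
      using that R0 by (simp add: norm_inverse)
    also have "ereal r \<le> fps_conv_radius (fps_shift (n + 2) d)" using r by simp
    also have "\<dots> \<le> fps_conv_radius (fps_integral0 (fps_shift (n + 2) d))"
      by (rule fps_conv_radius_integral_ge)
    finally show "ereal (norm (inverse (complex_of_real x))) <
        fps_conv_radius (fps_integral0 (fps_shift (n + 2) d))" .
  qed auto
  have Im_Hn: "Im (Hn (of_real x)) = Re (fps_nth d (Suc n)) * Im (Ln (\<i> * of_real x))"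
    if "\<bar>x\<bar> = R" for x
  proof -
    have "(\<Sum>k<n. fps_nth d (Suc k) * of_real x ^ (n - k) / of_nat (n - k)) \<in> \<real>"
      using real by (intro sum_in_Reals Reals_mult Reals_divide) auto
    then show ?thesis
      using Psi[OF that] real[of "Suc n"] by (simp add: Hn_def complex_is_Real_iff)
  qed
  \<comment> \<open>Multiplication by i moves \<open>R\<close> and \<open>-R\<close> to the positive
    and negative imaginary axis.\<close>
  have "Im (Ln (\<i> * of_real R)) = pi / 2" "Im (Ln (\<i> * of_real (-R))) = - pi / 2"
    using R0 Im_Ln_eq_pi_half[of "\<i> * of_real R"] Im_Ln_eq_pi_half[of "\<i> * of_real (-R)"] by auto
  then have h: "Im (Hn (of_real R)) = Re (fps_nth d (Suc n)) * (pi / 2)"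
    "Im (Hn (of_real (-R))) = Re (fps_nth d (Suc n)) * (- pi / 2)"
    using Im_Hn[of R] Im_Hn[of "-R"] R0 by simp_all
  have lim: "Im (Hn (of_real R) - Hn (of_real (-R))) = pi * Re (fps_nth d (Suc n))"
    by (simp only: minus_complex.sel h) simp
  have "((\<lambda>e. Im (Hn (Complex R (-e)) - Hn (Complex (-R) (-e)))) \<longlongrightarrow> 
      Im (Hn (of_real R) - Hn (of_real (-R)))) (at_right 0)"
    using R0 by (intro tendsto_Im tendsto_diff cont) auto
  then show ?thesis
    unfolding lim
    by (rule Lim_transform_eventually) (auto simp: int eventually_at_right_less intro: eventually_mono[OF eventually_at_right_less])
qed

text \<open>The normalised densities are probability measures on one compact interval, hence tight,
  and a subsequence converges weakly. Powers are bounded and continuous on \<open>[-R, R]\<close>,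
  so the moments pass to the limit.\<close>

lemma moment_sequence_if_density_limit:
  fixes \<rho> :: "nat \<Rightarrow> real \<Rightarrow> real"
  assumes R: "R > 0"
    and cont: "\<And>k. continuous_on {-R..R} (\<rho> k)"
    and nonneg: "\<And>k x. x \<in> {-R..R} \<Longrightarrow> 0 \<le> \<rho> k x"
    and lim: "\<And>n. (\<lambda>k. \<integral>x. indicator {-R..R} x * (x ^ n * \<rho> k x) \<partial>lborel) \<longlonglongrightarrow> s n"
    and s0: "s 0 = 1"
  shows "moment_sequence s"
proof -
  \<comment> \<open>The total masses tend to \<open>s 0 = 1\<close>; from the index \<open>N\<close>
    on they are positive and can be divided out.\<close>
  define m where "m k = (\<integral>x. indicator {-R..R} x * \<rho> k x \<partial>lborel)" for k
  have "m \<longlonglongrightarrow> 1" using lim[of 0] s0 by (simp add: m_def[abs_def])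
  then have "eventually (\<lambda>k. m k > 0) sequentially" by (rule order_tendstoD) simp
  then obtain N where N: "\<And>k. k \<ge> N \<Longrightarrow> m k > 0" by (auto simp: eventually_sequentially)
  define f where "f k x = indicator {-R..R} x * \<rho> (k + N) x / m (k + N)" for k x
  define \<mu> where "\<mu> k = density lborel (\<lambda>x. ennreal (f k x))" for k
  have f_nonneg: "0 \<le> f k x" for k x
    using nonneg[of x "k + N"] N[of "k + N"] by (auto simp: f_def split: split_indicator)
  have integrable: "integrable lborel (\<lambda>x. indicator {-R..R} x * (g x * \<rho> k x))"
    if "continuous_on {-R..R} g" for k and g :: "real \<Rightarrow> real"
    using borel_integrable_atLeastAtMost'[OF continuous_on_mult[OF that cont[of k]]]
    by (simp add: set_integrable_def)
  have f_integrable: "integrable lborel (f k)" for k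
    using integrable[of "\<lambda>_. 1" "k + N"] by (simp add: f_def[abs_def])
  have meas[measurable]: "f k \<in> borel_measurable borel" for k
    using borel_measurable_integrable[OF f_integrable[of k]] by simp
  have meas'[measurable]: "(\<lambda>x. ennreal (f k x)) \<in> borel_measurable borel" for k
    by measurable
  have \<mu>_integral: "integral\<^sup>L (\<mu> k) g = (\<integral>x. indicator {-R..R} x * (g x * \<rho> (k + N) x) \<partial>lborel) / m (k + N)"
    if [measurable]: "g \<in> borel_measurable borel" for k and g :: "real \<Rightarrow> real"
  proof -
    have "integral\<^sup>L (\<mu> k) g = (\<integral>x. f k x *\<^sub>R g x \<partial>lborel)"
      unfolding \<mu>_def by (intro integral_density) (auto simp: f_nonneg)
    also have "(\<lambda>x. f k x *\<^sub>R g x) = (\<lambda>x. indicator {-R..R} x * (g x * \<rho> (k + N) x) / m (k + N))"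
      by (auto simp: f_def)
    finally show ?thesis by simp
  qed
  have dist: "real_distribution (\<mu> k)" for k
  proof -
    have "emeasure (\<mu> k) (space (\<mu> k)) = (\<integral>\<^sup>+x. ennreal (f k x) \<partial>lborel)"
      by (simp add: \<mu>_def emeasure_density)
    also have "\<dots> = ennreal (integral\<^sup>L lborel (f k))"
      by (rule nn_integral_eq_integral) (auto simp: f_integrable f_nonneg)
    also have "integral\<^sup>L lborel (f k) = 1"
      using N[of "k + N"] by (simp add: f_def[abs_def] m_def)
    finally have "prob_space (\<mu> k)" by (intro prob_spaceI) simp
    then show ?thesis
      by (simp add: real_distribution_def real_distribution_axioms_def \<mu>_def)
  qed
  \<comment> \<open>Tightness is phrased with intervals open on the left, so the left end is moved
    to \<open>-R-1\<close> to keep \<open>-R\<close> inside.\<close>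
  have "measure (\<mu> k) {-R-1<..R} = 1" for k
  proof -
    interpret real_distribution "\<mu> k" by (rule dist)
    have "AE x in \<mu> k. x \<in> {-R-1<..R}"
      unfolding \<mu>_def by (subst AE_density) (use meas' in \<open>auto simp: f_def split: split_indicator\<close>)
    then show ?thesis by (subst prob_eq_1) auto
  qed
  then have "tight \<mu>"
    unfolding tight_def using dist R
    by (intro conjI allI impI exI[of _ "-R-1"] exI[of _ R]) auto
  then obtain t M where t: "strict_mono t" and M: "real_distribution M" and conv: "weak_conv_m (\<mu> \<circ> t) M"
    using tight_imp_convergent_subsubsequence[of \<mu> "\<lambda>k. k"] by (auto simp: strict_mono_def o_def)
  interpret M: real_distribution M by (rule M)
  \<comment> \<open>Pushing \<open>M\<close> forward along the truncation avoids proving that \<open>M\<close> is supported in \<open>[-R, R]\<close>.\<close>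
  define clip where "clip x = max (-R) (min R x)" for x :: real
  have clip: "isCont clip x" "\<bar>clip x\<bar> \<le> R" "x \<in> {-R..R} \<Longrightarrow> clip x = x" for x
    using R by (auto simp: clip_def[abs_def] intro!: continuous_intros)
  have [measurable]: "clip \<in> borel_measurable borel"
    by (intro borel_measurable_continuous_onI continuous_at_imp_continuous_on) (simp add: clip)
  have clip_int: "(\<integral>x. clip x ^ n \<partial>M) = s n" for n
  proof (rule LIMSEQ_unique)
    have bound: "\<bar>clip x ^ n\<bar> \<le> R ^ n" for x
      using clip(2)[of x] by (simp add: power_abs power_mono)
    show "(\<lambda>k. \<integral>x. clip x ^ n \<partial>((\<mu> \<circ> t) k)) \<longlonglongrightarrow> (\<integral>x. clip x ^ n \<partial>M)"
      by (rule weak_conv_imp_integral_bdd_continuous_conv[where B = "R ^ n"])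
        (use dist M conv bound clip(1) in \<open>auto simp: o_def intro!: continuous_intros\<close>)
    \<comment> \<open>Each \<open>\<mu> k\<close> lives on \<open>[-R, R]\<close>, where
      \<open>clip\<close> is the identity, so its clipped moments are its true moments.\<close>
    have "(\<integral>x. clip x ^ n \<partial>\<mu> k) = 
       (\<integral>x. indicator {-R..R} x * (x ^ n * \<rho> (k + N) x) \<partial>lborel) / m (k + N)" for k
      by (subst \<mu>_integral) (auto intro!: Bochner_Integration.integral_cong simp: clip(3) split: split_indicator)
    moreover have "(\<lambda>k. (\<integral>x. indicator {-R..R} x * (x ^ n * \<rho> (k + N) x) \<partial>lborel) / m (k + N))
        \<longlonglongrightarrow> s n / 1"
      using LIMSEQ_ignore_initial_segment[OF lim[of n], of N] LIMSEQ_ignore_initial_segment[OF \<open>m \<longlonglongrightarrow> 1\<close>, of N]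
      by (intro tendsto_divide) auto
    ultimately have "(\<lambda>k. \<integral>x. clip x ^ n \<partial>\<mu> k) \<longlonglongrightarrow> s n" by simp
    from LIMSEQ_subseq_LIMSEQ[OF this t]
    show "(\<lambda>k. \<integral>x. clip x ^ n \<partial>((\<mu> \<circ> t) k)) \<longlonglongrightarrow> s n" by (simp add: o_def)
  qed
  define M' where "M' = distr M borel clip"
  have "real_distribution M'"
    unfolding M'_def by (rule M.real_distribution_distr) simp
  moreover have "integrable M' (\<lambda>x. x ^ n)" for n
    unfolding M'_def
  proof (subst integrable_distr_eq)
    show "integrable M (\<lambda>x. clip x ^ n)"
      by (rule M.integrable_const_bound[of _ "R ^ n"]) (auto simp: clip power_abs power_mono)
  qed auto
  moreover have "s n = (\<integral>x. x ^ n \<partial>M')" for n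
    unfolding M'_def by (subst integral_distr) (auto simp: clip_int)
  ultimately show ?thesis unfolding moment_sequence_def by blast
qed

text \<open>Factoring out \<open>a - b\<close> leaves \<open>n\<close> products of norm at most
  \<open>M ^ (n - 1)\<close>. This controls the error of replacing powers of \<open>x - i e\<close>
  by powers of \<open>x\<close>.\<close>

lemma norm_power_diff_le:
  fixes a b :: complex
  assumes "norm a \<le> M" "norm b \<le> M"
  shows "norm (a ^ n - b ^ n) \<le> norm (a - b) * (of_nat n * M ^ (n - 1))"
proof -
  have M: "0 \<le> M" using assms norm_ge_zero order_trans by blast
  have "a ^ n - b ^ n = (a - b) * (\<Sum>i<n. b ^ (n - Suc i) * a ^ i)"
    by (rule power_diff_sumr2)
  moreover have "norm (\<Sum>i<n. b ^ (n - Suc i) * a ^ i) \<le> of_nat (card {..<n}) * M ^ (n - 1)"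
  proof (rule sum_norm_bound)
    fix i assume i: "i \<in> {..<n}"
    have "norm (b ^ (n - Suc i) * a ^ i) \<le> M ^ (n - Suc i) * M ^ i"
      unfolding norm_mult norm_power
      using assms M by (intro mult_mono power_mono) auto
    also have "\<dots> = M ^ (n - 1)" using i by (simp flip: power_add)
    finally show "norm (b ^ (n - Suc i) * a ^ i) \<le> M ^ (n - 1)" .
  qed
  ultimately show ?thesis by (simp add: norm_mult mult_left_mono)
qed

text \<open>
  Algebraicity enters through \<open>bound\<close>: \<open>G\<close> has at most one real pole \<open>b/a\<close>, of order at most one, so
  \<open>\<epsilon> G(x - i\<epsilon>)\<close> is bounded and tends to \<open>0\<close> almost everywhere.
\<close>
lemma moment_sequence_if_Pick:
  fixes d :: "complex fps" and G :: "complex \<Rightarrow> complex" and a b :: real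
  assumes hol: "G holomorphic_on {u. Im u < 0}"
    and Pick: "\<And>u. Im u < 0 \<Longrightarrow> 0 \<le> Im (G u)"
    and r: "0 < r" "ereal r \<le> fps_conv_radius d"
    and real: "\<And>n. fps_nth d n \<in> \<real>" and d0: "fps_nth d 0 = 0" and d1: "fps_nth d 1 = 1"
    and G: "\<And>u. Im u < 0 \<Longrightarrow> norm (inverse u) < r \<Longrightarrow> G u = eval_fps d (inverse u)"
    and ab: "a \<noteq> 0 \<or> b \<noteq> 0"
    and bound: "\<And>R. \<exists>C. \<forall>u. Im u < 0 \<longrightarrow> norm u \<le> R \<longrightarrow> norm (G u) * norm (of_real a * u - of_real b) \<le> C"
  shows "moment_sequence (\<lambda>n. Re (fps_nth d (Suc n)))"
proof -
  define R where "R = inverse r + 1"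
  have R: "0 < R" "inverse r < R" using r by (auto simp: R_def add_pos_pos)
  define e where "e k = inverse (real (Suc k))" for k
  have e: "0 < e k" "e k \<le> 1" for k by (auto simp: e_def field_simps)
  have e_lim: "e \<longlonglongrightarrow> 0"
    unfolding e_def by (rule LIMSEQ_inverse_real_of_nat)
  then have e_right: "filterlim e (at_right 0) sequentially"
    using e(1) by (auto simp: filterlim_at less_imp_neq[THEN not_sym])
  define u where "u k x = Complex x (- e k)" for k x
  have u_Im: "Im (u k x) < 0" and u_diff: "norm (of_real x - u k x) = e k" for k x
    using e[of k] by (auto simp: u_def cmod_def)
  have u_norm: "norm (u k x) \<le> R + 1" if "x \<in> {-R..R}" for k x
  proof -
    have "norm (u k x) \<le> norm (of_real x :: complex) + norm (of_real x - u k x)"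
      by norm
    with that e[of k] u_diff[of x k] show ?thesis by auto
  qed
  have cont_u: "continuous_on A (u k)" for A k
    unfolding u_def Complex_eq by (intro continuous_intros)
  have cont_G: "continuous_on A (\<lambda>x. G (u k x))" for A k
    by (rule continuous_on_compose2[OF holomorphic_on_imp_continuous_on[OF hol] cont_u])
      (auto simp: u_Im)
  obtain C where C: "\<And>v. Im v < 0 \<Longrightarrow> norm v \<le> R + 1 \<Longrightarrow>
      norm (G v) * norm (of_real a * v - of_real b) \<le> C"
    using bound[of "R + 1"] by blast
  \<comment> \<open>The linear factor that tames the pole. Its lower bound \<open>c * e k\<close>
    yields a constant dominating function, the lower bound by the distance at height
    \<open>0\<close> yields the pointwise limit.\<close>
  define N where "N k x = norm (of_real a * u k x - of_real b)" for k x
  define c where "c = (if a = 0 then \<bar>b\<bar> else \<bar>a\<bar>)"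
  have c: "c > 0" using ab by (auto simp: c_def)
  have N_ge: "c * e k \<le> N k x" "\<bar>a * x - b\<bar> \<le> N k x" for k x
  proof -
    show "\<bar>a * x - b\<bar> \<le> N k x"
      using abs_Re_le_cmod[of "of_real a * u k x - of_real b"] by (simp add: N_def u_def)
    show "c * e k \<le> N k x"
    \<comment> \<open>For \<open>a = 0\<close> the factor is constant and \<open>e k \<le> 1\<close>
      suffices; otherwise its imaginary part has modulus \<open>\<bar>a\<bar> * e k\<close>.\<close>
    proof (cases "a = 0")
      case True
      then show ?thesis using e[of k] by (simp add: c_def N_def mult_left_le)
    next
      case False
      then show ?thesis
        using abs_Im_le_cmod[of "of_real a * u k x - of_real b"] e[of k]
        by (simp add: N_def u_def c_def abs_mult)
    qed
  qed
  have N_pos: "N k x > 0" for k x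
    using N_ge(1)[of k x] c e(1)[of k] by (meson less_le_trans mult_pos_pos)
  have G_le: "norm (G (u k x)) \<le> C / N k x" if "x \<in> {-R..R}" for k x
    using C[OF u_Im u_norm[OF that], of k] N_pos[of k x] by (simp add: N_def field_simps)
  have C0: "0 \<le> C"
  proof -
    have "0 \<le> norm (G (-\<i>)) * norm (of_real a * (-\<i>) - of_real b)" by simp
    also have "\<dots> \<le> C" using R by (intro C) auto
    finally show ?thesis .
  qed
  \<comment> \<open>\<open>I\<close> is the integrand whose limit is known from contour integration;
    \<open>I'\<close> has the real power \<open>x ^ n\<close>, so that the imaginary part of its
    integral is \<open>pi\<close> times a moment of the density.\<close>
  define I where "I k n x = indicator {-R..R} x *\<^sub>R (u k x ^ n * G (u k x))" for k n x
  define I' where "I' k n x = indicator {-R..R} x *\<^sub>R (of_real x ^ n * G (u k x))" for k n x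
  have int: "integrable lborel (I k n)" "integrable lborel (I' k n)" for k n
    unfolding I_def[abs_def] I'_def[abs_def] 
    by (intro borel_integrable_atLeastAtMost'[unfolded set_integrable_def] continuous_intros cont_u cont_G)+
  \<comment> \<open>Dominated convergence: the difference of powers contributes a factor
    \<open>e k\<close>, which the bound on \<open>G\<close> by \<open>C / N k x\<close> cannot
    outweigh.\<close>
  have diff: "(\<lambda>k. \<integral>x. (I' k n x - I k n x) \<partial>lborel) \<longlonglongrightarrow> integral\<^sup>L lborel (\<lambda>x::real. 0)" for n
  proof (rule integral_dominated_convergence)
    define D where "D = real n * (R + 1) ^ (n - 1) * C"
    have D: "0 \<le> D" using R C0 by (simp add: D_def)
    have le: "norm (I' k n x - I k n x) \<le> e k * D / N k x" if "x \<in> {-R..R}" for k x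
    proof -
      have "norm (I' k n x - I k n x) = norm (of_real x ^ n - u k x ^ n) * norm (G (u k x))"
        using that by (simp add: I_def I'_def norm_mult flip: left_diff_distrib)
      also have "\<dots> \<le> (e k * (real n * (R + 1) ^ (n - 1))) * (C / N k x)"
        using norm_power_diff_le[of "of_real x" "R + 1" "u k x" n] that u_norm[OF that, of k] u_diff[of x k]
          G_le[OF that, of k] R e[of k]
        by (intro mult_mono) auto
      finally show ?thesis by (simp add: D_def)
    qed
    show "integrable lborel (\<lambda>x. indicator {-R..R} x *\<^sub>R (D / c))"
      using borel_integrable_atLeastAtMost'[of "-R" R "\<lambda>_. D / c"] by (simp add: set_integrable_def)
    show "AE x in lborel. norm (I' k n x - I k n x) \<le> indicator {-R..R} x *\<^sub>R (D / c)" for k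
    proof (rule AE_I2)
      fix x
      show "norm (I' k n x - I k n x) \<le> indicator {-R..R} x *\<^sub>R (D / c)"
      proof (cases "x \<in> {-R..R}")
        case True
        have "e k * D / N k x \<le> D / c"
          using mult_left_mono[OF N_ge(1)[of k x] D] N_pos[of k x] c by (simp add: field_simps)
        with le[OF True, of k] True show ?thesis by simp
      qed (simp add: I_def I'_def)
    qed
    show "AE x in lborel. (\<lambda>k. I' k n x - I k n x) \<longlonglongrightarrow> 0"
    proof -
      \<comment> \<open>If \<open>a = 0\<close>, then \<open>b / a\<close> is \<open>0\<close> by
        convention; removing that point is harmless.\<close>
      have "AE x in lborel. x \<noteq> b / a" by (rule AE_lborel_singleton)
      then show ?thesis
      proof eventually_elim
        case (elim x)
        then have x: "\<bar>a * x - b\<bar> > 0" using ab by (cases "a = 0") (auto simp: field_simps)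
        show ?case
        proof (cases "x \<in> {-R..R}")
          case True
          show ?thesis
          proof (rule Lim_null_comparison)
            have "e k * D / N k x \<le> e k * D / \<bar>a * x - b\<bar>" for k
              using N_ge(2)[of x k] x D e[of k] N_pos[of k x] by (intro divide_left_mono) auto
            with le[OF True] show "\<forall>\<^sub>F k in sequentially. norm (I' k n x - I k n x) \<le> e k * D / \<bar>a * x - b\<bar>"
              using order_trans by (blast intro: always_eventually)
            show "(\<lambda>k. e k * D / \<bar>a * x - b\<bar>) \<longlonglongrightarrow> 0"
              using e_lim x by (auto intro!: tendsto_eq_intros)
          qed
        qed (simp add: I_def I'_def)
      qed
    qed
    show "(\<lambda>x. I' k n x - I k n x) \<in> borel_measurable lborel" for k
      by (intro borel_measurable_integrable Bochner_Integration.integrable_diff int)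
  qed auto
  have lim: "(\<lambda>k. Im (\<integral>x. I' k n x \<partial>lborel)) \<longlonglongrightarrow> pi * Re (fps_nth d (Suc n))" for n
  proof -
    have "(\<lambda>k. Im (\<integral>x. I k n x \<partial>lborel)) \<longlonglongrightarrow> pi * Re (fps_nth d (Suc n))"
      unfolding I_def u_def
      by (rule filterlim_compose[OF moment_integral_tendsto[OF hol r R(2) real d0 G] e_right]) auto
    moreover have "(\<lambda>k. Im (\<integral>x. (I' k n x - I k n x) \<partial>lborel)) \<longlonglongrightarrow> 0"
      using tendsto_Im[OF diff[of n]] by simp
    ultimately show ?thesis
      using tendsto_add by (fastforce simp: Bochner_Integration.integral_diff int)
  qed
  show ?thesis
  proof (rule moment_sequence_if_density_limit[where R = R and \<rho> = "\<lambda>k x. Im (G (u k x)) / pi"])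
    show "continuous_on {-R..R} (\<lambda>x. Im (G (u k x)) / pi)" for k
      by (intro continuous_intros cont_G) auto
    show "0 \<le> Im (G (u k x)) / pi" for k x using Pick[OF u_Im] by simp
    fix n
    have "(\<integral>x. indicator {-R..R} x * (x ^ n * (Im (G (u k x)) / pi)) \<partial>lborel) =
        Im (\<integral>x. I' k n x \<partial>lborel) / pi" for k
    proof -
      have "Im (\<integral>x. I' k n x \<partial>lborel) = (\<integral>x. Im (I' k n x) \<partial>lborel)"
        by (rule integral_Im[symmetric, OF int(2)])
      also have "(\<lambda>x. Im (I' k n x)) = (\<lambda>x. (indicator {-R..R} x * (x ^ n * (Im (G (u k x)) / pi))) * pi)"
        by (auto simp: I'_def fun_eq_iff simp flip: of_real_power split: split_indicator)
      finally show ?thesis by simp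
    qed
    then show "(\<lambda>k. \<integral>x. indicator {-R..R} x * (x ^ n * (Im (G (u k x)) / pi)) \<partial>lborel)
        \<longlonglongrightarrow> Re (fps_nth d (Suc n))"
      using tendsto_divide[OF lim[of n] tendsto_const[of pi]] by simp
  qed (use R d1 in auto)
qed

section \<open>The inverse series as an analytic function\<close>

lemma fps_cplx_mult: "fps_cplx (f * g) = fps_cplx f * fps_cplx g"
  by (rule fps_ext) (simp add: fps_mult_nth)

lemma fps_cplx_power: "fps_cplx (f ^ n) = fps_cplx f ^ n"
proof (induction n)
  case 0
  then show ?case by (intro fps_ext) (simp add: fps_one_nth)
next
  case (Suc n)
  then show ?case by (simp add: fps_cplx_mult)
qed

lemma fps_cplx_compose: "fps_cplx (f oo g) = fps_cplx f oo fps_cplx g"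
proof (rule fps_ext)
  fix n
  have "fps_nth (fps_cplx g ^ i) n = of_real (fps_nth (g ^ i) n)" for i
    by (simp flip: fps_cplx_power)
  then show "fps_nth (fps_cplx (f oo g)) n = fps_nth (fps_cplx f oo fps_cplx g) n"
    by (simp add: fps_compose_nth)
qed

lemma fps_cplx_of_poly: "fps_cplx (fps_of_poly p) = fps_of_poly (cpoly p)"
  by (rule fps_ext) (simp add: coeff_map_poly)

text \<open>This is \<open>F(D(z)) = z\<close> with the denominator cleared, a form that transfers
  coefficientwise to complex series.\<close>

lemma poly_compose_invD:
  assumes "F \<in> ratF"
  shows "fps_of_poly ([:0, 1:] * numP F) oo invD F = fps_X * (fps_of_poly (denQ F) oo invD F)"
proof -
  have D0: "fps_nth (invD F) 0 = 0" using invD_props[OF assms] by simp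
  have "(fpsF F * fps_of_poly (denQ F)) oo invD F = (fps_X * fps_of_poly (numP F)) oo invD F"
    by (simp add: fpsF_props[OF assms])
  then have "fps_X * (fps_of_poly (denQ F) oo invD F) = (fps_X * fps_of_poly (numP F)) oo invD F"
    by (simp add: fps_compose_mult_distrib[OF D0] invD_props[OF assms])
  then show ?thesis by (simp add: fps_of_poly_mult fps_of_poly_pCons mult.commute[of _ fps_X])
qed

section \<open>Complex values, poles and derivative of F\<close>

lemma poly_cpoly_0 [simp]: "poly (cpoly p) 0 = of_real (poly p 0)"
  by (simp add: poly_0_coeff_0 coeff_map_poly)

text \<open>At a root of \<open>denQ F\<close> the convention for division makes this
  \<open>0\<close>, which is not a value of \<open>F\<close>; statements about fibres therefore
  carry the condition that the denominator is nonzero.\<close>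

definition ratF_val :: "real poly fract \<Rightarrow> complex \<Rightarrow> complex" where
  "ratF_val F w = w * poly (cpoly (numP F)) w / poly (cpoly (denQ F)) w"

lemma ratF_P0_Q0:
  assumes "F \<in> ratF"
  shows "poly (numP F) 0 = 1" "poly (denQ F) 0 = 1"
  using represents_numP_denQ[OF assms] by (auto simp: represents_def)

text \<open>Unlike mere coprimality over the reals, a Bezout identity can be evaluated at complex
  points, where it excludes common roots.\<close>

lemma bezout_ratF:
  assumes "F \<in> ratF"
  obtains u v where "u * numP F + v * denQ F = 1"
proof -
  have "coprime (numP F) (denQ F)"
    using represents_numP_denQ[OF assms] by (simp add: represents_def)
  then show ?thesis
    using that bezout_coefficients_fst_snd[of "numP F" "denQ F"] by simp
qed

lemma cpoly_mult: "cpoly (p * q) = cpoly p * cpoly q"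
  by (rule poly_eqI) (simp add: coeff_map_poly coeff_mult)

lemma cpoly_add: "cpoly (p + q) = cpoly p + cpoly q"
  by (rule poly_eqI) (simp add: coeff_map_poly)

lemma cpoly_diff: "cpoly (p - q) = cpoly p - cpoly q"
  by (rule poly_eqI) (simp add: coeff_map_poly)

lemma cpoly_pderiv: "cpoly (pderiv p) = pderiv (cpoly p)"
  by (rule poly_eqI) (simp add: coeff_map_poly coeff_pderiv)

text \<open>If the denominator vanished at \<open>w\<close>, so would the numerator. The point
  \<open>w = 0\<close> is excluded by \<open>Q(0) = 1\<close>, and elsewhere the Bezout identity
  would read \<open>0 = 1\<close>.\<close>

lemma denQ_nz_if_root:
  assumes F: "F \<in> ratF" and root: "w * poly (cpoly (numP F)) w = z * poly (cpoly (denQ F)) w"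
  shows "poly (cpoly (denQ F)) w \<noteq> 0"
proof
  assume q: "poly (cpoly (denQ F)) w = 0"
  then have "w \<noteq> 0" using ratF_P0_Q0[OF F] by auto
  with q root have p: "poly (cpoly (numP F)) w = 0" by simp
  obtain u v where "u * numP F + v * denQ F = 1" by (rule bezout_ratF[OF F])
  then have "poly (cpoly (u * numP F + v * denQ F)) w = poly (cpoly 1) w" by simp
  then show False using p q by (simp add: cpoly_add cpoly_mult)
qed

lemma ratF_val_eq_iff:
  assumes "F \<in> ratF"
  shows "w * poly (cpoly (numP F)) w = z * poly (cpoly (denQ F)) w \<longleftrightarrow>
         poly (cpoly (denQ F)) w \<noteq> 0 \<and> ratF_val F w = z"
  using denQ_nz_if_root[OF assms, of w z]
  by (cases "poly (cpoly (denQ F)) w = 0") (auto simp: ratF_val_def field_simps)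

lemma ratF_val_has_field_derivative:
  assumes "poly (cpoly (denQ F)) w \<noteq> 0"
  shows "(ratF_val F has_field_derivative
          poly (cpoly (chiF F)) w / poly (cpoly (denQ F)) w ^ 2) (at w)"
proof -
  have "((\<lambda>w. poly ([:0, 1:] * cpoly (numP F)) w / poly (cpoly (denQ F)) w) has_field_derivative
          poly (cpoly (chiF F)) w / poly (cpoly (denQ F)) w ^ 2) (at w)"
    using assms
    by (auto intro!: derivative_eq_intros simp: chiF_def cpoly_diff cpoly_mult cpoly_add cpoly_pderiv
       power2_eq_square pderiv_pCons pderiv_mult) (simp add: algebra_simps map_poly_pCons cpoly_mult cpoly_pderiv)
  moreover have "(\<lambda>w. poly ([:0, 1:] * cpoly (numP F)) w / poly (cpoly (denQ F)) w) = ratF_val F"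
    by (simp add: fun_eq_iff ratF_val_def)
  ultimately show ?thesis by simp
qed

lemma open_denQ_nz: "open {w. poly (cpoly (denQ F)) w \<noteq> 0}"
  by (intro open_Collect_neq continuous_intros)

lemma ratF_val_holomorphic:
  "ratF_val F holomorphic_on {w. poly (cpoly (denQ F)) w \<noteq> 0}"
  unfolding ratF_val_def by (intro holomorphic_intros) auto

text \<open>Since \<open>F'(0) = 1\<close>, \<open>F\<close> is injective near \<open>0\<close> and
  has a holomorphic inverse there. Its Taylor series satisfies the same cleared equation as
  \<open>invD F\<close>, and the formal inverse is unique, so the two series agree. Hence
  \<open>invD F\<close> has positive radius, and every small root of the cleared equation for small
  \<open>z\<close> is \<open>D(z)\<close>.\<close>

lemma local_inverse_at_0:
  assumes F: "F \<in> ratF"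
  obtains r e where "0 < r" "0 < e" "ereal r \<le> fps_conv_radius (fps_cplx (invD F))"
    "\<And>w z. norm w < e \<Longrightarrow> norm z < r \<Longrightarrow> w * poly (cpoly (numP F)) w = z * poly (cpoly (denQ F)) w
      \<Longrightarrow> w = eval_fps (fps_cplx (invD F)) z"
    "\<And>z. norm z < r \<Longrightarrow> poly (cpoly (denQ F)) (eval_fps (fps_cplx (invD F)) z) \<noteq> 0 \<and>
      ratF_val F (eval_fps (fps_cplx (invD F)) z) = z"
proof -
  define p where "p = cpoly (numP F)"
  define q where "q = cpoly (denQ F)"
  define f where "f = ratF_val F"
  define S where "S = {w. poly q w \<noteq> 0}"
  have S: "open S" "0 \<in> S" "f holomorphic_on S"
    using open_denQ_nz[of F] ratF_val_holomorphic[of F] ratF_P0_Q0[OF F] by (auto simp: S_def q_def f_def)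
  have "(f has_field_derivative 1) (at 0)"
    using ratF_val_has_field_derivative[of F 0] ratF_P0_Q0[OF F]
    by (simp add: f_def chiF_def)
  then have "deriv f 0 \<noteq> 0" using DERIV_imp_deriv by fastforce
  then obtain e where e: "0 < e" "ball 0 e \<subseteq> S" "inj_on f (ball 0 e)"
    using has_complex_derivative_locally_injective[OF S(3) S(2,1)] by metis
  have hol: "f holomorphic_on ball 0 e" using S e holomorphic_on_subset by blast
  obtain g where g: "g holomorphic_on f ` ball 0 e" "\<And>w. w \<in> ball 0 e \<Longrightarrow> g (f w) = w"
    using holomorphic_has_inverse[OF hol open_ball e(3)] by metis
  have "open (f ` ball 0 e)" using open_mapping_thm3[OF hol open_ball e(3)] .
  moreover have f0: "f 0 = 0" by (simp add: f_def ratF_val_def)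
  then have "0 \<in> f ` ball 0 e" using e by (force intro: image_eqI[of _ _ 0])
  ultimately obtain r where r: "0 < r" "ball 0 r \<subseteq> f ` ball 0 e" by (meson openE)
  have g_hol: "g holomorphic_on ball 0 r" using g r holomorphic_on_subset by blast
  have fg: "g z \<in> ball 0 e \<and> f (g z) = z" if "norm z < r" for z
    using that r(2) g(2) by (force simp: subset_iff)
  define d where "d = fps_expansion g 0"
  have "g analytic_on {0}"
    using g_hol r by (auto simp: analytic_at intro!: exI[of _ "ball 0 r"])
  then have gd: "g has_fps_expansion d"
    unfolding d_def by (simp add: analytic_at_imp_has_fps_expansion_0)
  have "g 0 = 0" using g(2)[of 0] e f0 by simp
  then have d0: "fps_nth d 0 = 0"
    using has_fps_expansion_imp_0_eq_fps_nth_0[OF gd] by simp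
  have poly_comp: "(poly h \<circ> g) has_fps_expansion (fps_of_poly h oo d)" for h
    by (rule has_fps_expansion_compose[OF _ gd d0]) (simp add: has_fps_expansion_def)
  have "(\<lambda>z. z * (poly q \<circ> g) z) has_fps_expansion (fps_X * (fps_of_poly q oo d))"
    by (intro has_fps_expansion_mult has_fps_expansion_fps_X poly_comp)
  moreover have "eventually (\<lambda>z. z * (poly q \<circ> g) z = (poly ([:0,1:] * p) \<circ> g) z) (nhds 0)"
  proof -
    have "z * (poly q \<circ> g) z = (poly ([:0,1:] * p) \<circ> g) z" if "norm z < r" for z
    proof -
      have "poly q (g z) \<noteq> 0" using fg[OF that] e(2) by (auto simp: S_def)
      then show ?thesis
        using fg[OF that] by (auto simp: f_def ratF_val_def p_def q_def field_simps)
    qed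
    then show ?thesis
      using eventually_nhds_ball[OF r(1), of 0] by (auto elim!: eventually_mono)
  qed
  ultimately have "(poly ([:0,1:] * p) \<circ> g) has_fps_expansion (fps_X * (fps_of_poly q oo d))"
    by (rule has_fps_expansion_cong[OF _ refl, THEN iffD1, rotated])
  with poly_comp have dc: "fps_of_poly ([:0,1:] * p) oo d = fps_X * (fps_of_poly q oo d)"
    using fps_expansion_unique_complex by blast
  have d_eq: "d = fps_cplx (invD F)"
  proof -
    define e where "e = fps_cplx (invD F)"
    define h where "h = fps_of_poly ([:0,1:] * p) / fps_of_poly q"
    have q0: "fps_nth (fps_of_poly q) 0 = 1" and p0: "coeff p 0 = 1"
      using ratF_P0_Q0[OF F] by (simp_all add: q_def p_def coeff_map_poly poly_0_coeff_0)
    then have h: "h * fps_of_poly q = fps_of_poly ([:0,1:] * p)"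
      by (simp add: h_def fps_divide_unit mult.assoc inverse_mult_eq_1)
    have h0: "fps_nth h 0 = 0" "fps_nth h 1 \<noteq> 0"
      using q0 p0 by (simp_all add: h_def fps_divide_unit fps_mult_nth_1 coeff_pCons)
    \<comment> \<open>Composing with \<open>h\<close> reduces the cleared equation to
      \<open>h oo b = fps_X\<close>, because \<open>fps_of_poly q oo b\<close> has constant term
      \<open>1\<close> and cancels.\<close>
    have inv: "b = fps_inv h" if b0: "fps_nth b 0 = 0"
      and b: "fps_of_poly ([:0,1:] * p) oo b = fps_X * (fps_of_poly q oo b)" for b
    proof -
      have "(h oo b) * (fps_of_poly q oo b) = fps_X * (fps_of_poly q oo b)"
        by (simp only: fps_compose_mult_distrib[OF b0, symmetric] h b)
      moreover have "fps_nth (fps_of_poly q oo b) 0 \<noteq> 0" using q0 by simp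
      then have "fps_of_poly q oo b \<noteq> 0" by force
      ultimately have hb: "h oo b = fps_X" by simp
      have "b = (fps_inv h oo h) oo b" by (simp add: fps_inv[OF h0] b0)
      also have "\<dots> = fps_inv h oo (h oo b)" by (rule fps_compose_assoc[OF b0 h0(1), symmetric])
      finally show ?thesis by (simp add: hb)
    qed
    have "e = fps_inv h"
    proof (rule inv)
      show "fps_nth e 0 = 0" using invD_props[OF F] by (simp add: e_def)
      have "fps_cplx (fps_of_poly ([:0, 1:] * numP F) oo invD F)
          = fps_cplx (fps_X * (fps_of_poly (denQ F) oo invD F))"
        by (simp only: poly_compose_invD[OF F])
      moreover have "fps_cplx fps_X = fps_X" by (rule fps_ext) (simp add: fps_X_def)
      moreover have "cpoly [:0, 1:] = [:0, 1:]" by (simp add: map_poly_pCons)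
      ultimately show "fps_of_poly ([:0,1:] * p) oo e = fps_X * (fps_of_poly q oo e)"
        by (simp only: fps_cplx_compose fps_cplx_mult fps_cplx_of_poly cpoly_mult e_def p_def q_def)
    qed
    with inv[OF d0 dc] show ?thesis by (simp add: e_def)
  qed
  have d_eval: "eval_fps d z = g z" if "norm z < r" for z
    using has_fps_expansion_imp_eval_fps_eq[OF gd that g_hol] .
  show ?thesis
  proof (rule that[OF r(1) e(1)]; unfold d_eq[symmetric])
    show "ereal r \<le> fps_conv_radius d"
      using holomorphic_on_imp_fps_conv_radius_ge[OF gd, of "ereal r"] g_hol by simp
  next
    fix w z assume "norm w < e" "norm z < r"
      "w * poly (cpoly (numP F)) w = z * poly (cpoly (denQ F)) w"
    then have "f w = z" using ratF_val_eq_iff[OF F] by (simp add: f_def)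
    with g(2)[of w] \<open>norm w < e\<close> d_eval[OF \<open>norm z < r\<close>] show "w = eval_fps d z" by simp
  next
    fix z :: complex assume z: "norm z < r"
    show "poly (cpoly (denQ F)) (eval_fps d z) \<noteq> 0 \<and> ratF_val F (eval_fps d z) = z"
      using fg[OF z] e(2) by (auto simp: d_eval[OF z] f_def S_def q_def)
  qed
qed

lemma fps_conv_radius_invD_pos:
  assumes "F \<in> ratF"
  shows "fps_conv_radius (fps_cplx (invD F)) > 0"
proof (rule local_inverse_at_0[OF assms])
  fix r :: real assume "0 < r" "ereal r \<le> fps_conv_radius (fps_cplx (invD F))"
  then show ?thesis by (metis ereal_less(2) less_le_trans)
qed

section \<open>Fibres of a rational function with real critical values\<close>

lemma order_ge_2_iff:
  fixes p :: "complex poly"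
  assumes "p \<noteq> 0"
  shows "2 \<le> order a p \<longleftrightarrow> poly p a = 0 \<and> poly (pderiv p) a = 0"
proof (cases "poly p a = 0")
  case True
  have nz: "pderiv p \<noteq> 0"
  proof
    assume "pderiv p = 0"
    then have "degree p = 0" by (simp add: pderiv_eq_0_iff)
    then obtain c where "p = [:c:]" by (rule degree_eq_zeroE)
    with True assms show False by simp
  qed
  have "order a p = Suc (order a (pderiv p))"
    by (rule order_pderiv[OF assms True])
  with True nz show ?thesis by (auto simp: order_root)
qed (simp add: order_root)

text \<open>Its roots form the fibre of \<open>F\<close> over \<open>z\<close>, poles being excluded
  automatically by coprimality.\<close>

definition root_poly :: "real poly fract \<Rightarrow> complex \<Rightarrow> complex poly" where
  "root_poly F z = [:0, 1:] * cpoly (numP F) - smult z (cpoly (denQ F))"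

lemma root_poly_eq_0_iff:
  "poly (root_poly F z) w = 0 \<longleftrightarrow> w * poly (cpoly (numP F)) w = z * poly (cpoly (denQ F)) w"
  by (simp add: root_poly_def)

lemma root_poly_nz:
  assumes F: "F \<in> ratF" shows "root_poly F z \<noteq> 0"
proof
  assume 0: "root_poly F z = 0"
  have "poly (root_poly F z) 0 = - z" using ratF_P0_Q0[OF F] by (simp add: root_poly_def)
  with 0 have "z = 0" by simp
  with 0 have "cpoly (numP F) = 0" by (simp add: root_poly_def)
  then have "poly (cpoly (numP F)) 0 = 0" by simp
  then show False using ratF_P0_Q0[OF F] by simp
qed

text \<open>Substituting \<open>w P(w) = z Q(w)\<close> into the characteristic polynomial leaves a
  factor \<open>Q(w)\<close>. As this is nonzero on a fibre, multiple roots of a fibre are exactly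
  the roots of \<open>chiF F\<close> in it.\<close>

lemma chiF_at_root:
  assumes "poly (root_poly F z) w = 0"
  shows "poly (cpoly (chiF F)) w = poly (cpoly (denQ F)) w * poly (pderiv (root_poly F z)) w"
proof -
  have "poly (cpoly (chiF F)) w = 
     (poly (cpoly (numP F)) w + w * poly (pderiv (cpoly (numP F))) w) * poly (cpoly (denQ F)) w
     - (w * poly (cpoly (numP F)) w) * poly (pderiv (cpoly (denQ F))) w"
    by (simp add: chiF_def cpoly_diff cpoly_mult cpoly_add cpoly_pderiv map_poly_pCons)
  also have "w * poly (cpoly (numP F)) w = z * poly (cpoly (denQ F)) w"
    using assms by (simp add: root_poly_eq_0_iff)
  finally show ?thesis
    by (simp add: root_poly_def pderiv_diff pderiv_mult pderiv_smult pderiv_pCons algebra_simps)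
qed

lemma critN_iff:
  assumes F: "F \<in> ratF"
  shows "z \<in> critN F \<longleftrightarrow> (\<exists>w. poly (cpoly (denQ F)) w \<noteq> 0 \<and> ratF_val F w = z \<and> poly (cpoly (chiF F)) w = 0)"
proof -
  have "z \<in> critN F \<longleftrightarrow> (\<exists>w. poly (root_poly F z) w = 0 \<and> poly (pderiv (root_poly F z)) w = 0)"
    unfolding critN_def root_poly_def[symmetric] by (simp add: order_ge_2_iff[OF root_poly_nz[OF F]])
  also have "\<dots> \<longleftrightarrow> (\<exists>w. poly (root_poly F z) w = 0 \<and> poly (cpoly (chiF F)) w = 0)"
    using denQ_nz_if_root[OF F] by (intro ex_cong1 conj_cong refl) (simp add: chiF_at_root flip: root_poly_eq_0_iff)
  finally show ?thesis by (simp add: root_poly_eq_0_iff ratF_val_eq_iff[OF F])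
qed

lemma poly_cpoly_of_real: "poly (cpoly p) (of_real x) = of_real (poly p x)"
  by (induction p) (auto simp: map_poly_pCons)

lemma ratF_val_of_real: "ratF_val F (of_real x) \<in> \<real>"
  by (simp add: ratF_val_def poly_cpoly_of_real)

text \<open>A critical value is the value of \<open>F\<close> at a root of \<open>chiF F\<close>,
  and \<open>F\<close> is real at real points.\<close>

lemma ratF_rr0_subset_ratF_rr: "ratF_rr0 \<subseteq> ratF_rr"
  by (auto simp: ratF_rr0_def ratF_rr_def critN_iff) (metis Reals_cases ratF_val_of_real)

text \<open>For \<open>F\<close> in \<open>ratF\<close> this is the degree of \<open>F\<close> as a
  self-map of the Riemann sphere.\<close>

definition ratF_degree :: "real poly fract \<Rightarrow> nat" where
  "ratF_degree F = max (degree ([:0, 1:] * numP F)) (degree (denQ F))"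

lemma cpoly_X [simp]: "cpoly [:0, 1:] = [:0, 1:]"
  by (simp add: map_poly_pCons)

lemma ratF_degree_leading:
  assumes F: "F \<in> ratF"
  shows "coeff ([:0, 1:] * numP F) (ratF_degree F) \<noteq> 0 \<or> coeff (denQ F) (ratF_degree F) \<noteq> 0"
    and "ratF_degree F \<ge> 1"
proof -
  have nz: "[:0, 1:] * numP F \<noteq> 0" "denQ F \<noteq> 0" "numP F \<noteq> 0" using ratF_P0_Q0[OF F] by auto
  show "coeff ([:0, 1:] * numP F) (ratF_degree F) \<noteq> 0 \<or> coeff (denQ F) (ratF_degree F) \<noteq> 0"
    using nz(1,2)[folded leading_coeff_0_iff] unfolding ratF_degree_def max_def by metis
  have "degree ([:0, 1:] * numP F) \<ge> 1" using nz by (subst degree_mult_eq) auto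
  then show "ratF_degree F \<ge> 1" unfolding ratF_degree_def by linarith
qed

text \<open>The top coefficient is \<open>a - z * b\<close> with real \<open>a\<close>,
  \<open>b\<close> that are not both zero, so it cannot vanish for non-real \<open>z\<close>: no
  point of the fibre is at infinity.\<close>

lemma degree_root_poly:
  assumes F: "F \<in> ratF" and z: "Im z \<noteq> 0"
  shows "degree (root_poly F z) = ratF_degree F"
proof (rule antisym)
  let ?A = "[:0, 1:] * numP F" and ?m = "ratF_degree F"
  have eq: "root_poly F z = cpoly ?A - smult z (cpoly (denQ F))"
    unfolding cpoly_mult root_poly_def by simp
  show "degree (root_poly F z) \<le> ?m"
  proof (rule degree_le, intro allI impI)
    fix i assume "?m < i"
    then have "coeff ?A i = 0" "coeff (denQ F) i = 0"
      by (auto simp: ratF_degree_def intro!: coeff_eq_0 simp del: mult_pCons_left)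
    then show "coeff (root_poly F z) i = 0"
      unfolding eq by (simp add: coeff_map_poly del: mult_pCons_left)
  qed
  have "coeff (root_poly F z) ?m = of_real (coeff ?A ?m) - z * of_real (coeff (denQ F) ?m)"
    unfolding eq by (simp add: coeff_map_poly del: mult_pCons_left)
  also have "\<dots> \<noteq> 0"
    using ratF_degree_leading(1)[OF F] z by (auto simp: complex_eq_iff simp del: mult_pCons_left)
  finally show "?m \<le> degree (root_poly F z)" by (rule le_degree)
qed

text \<open>Counted with multiplicity there are \<open>ratF_degree F\<close> roots, and a non-real
  \<open>z\<close> is not critical, so all of them are simple.\<close>

lemma card_roots_root_poly:
  assumes F: "F \<in> ratF_rr" and z: "Im z \<noteq> 0"
  shows "card {w. poly (root_poly F z) w = 0} = ratF_degree F"
proof -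
  have F': "F \<in> ratF" using F by (simp add: ratF_rr_def)
  have nz: "root_poly F z \<noteq> 0" by (rule root_poly_nz[OF F'])
  have "z \<notin> critN F" using F z by (auto simp: ratF_rr_def complex_is_Real_iff)
  then have "order w (root_poly F z) < 2" for w
    unfolding critN_def root_poly_def[symmetric] by (auto simp: not_le)
  moreover have "order w (root_poly F z) > 0" if "poly (root_poly F z) w = 0" for w
    using that nz by (simp add: order_root)
  ultimately have one: "order w (root_poly F z) = 1" if "poly (root_poly F z) w = 0" for w
    using that by (metis One_nat_def Suc_leI le_antisym less_2_cases_iff nat_less_le)
  have "ratF_degree F = size (proots (root_poly F z))"
    by (simp add: size_proots_complex degree_root_poly[OF F' z])
  also have "\<dots> = (\<Sum>w | poly (root_poly F z) w = 0. 1)"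
    unfolding size_multiset_overloaded_eq using nz one by (intro sum.cong) auto
  finally show ?thesis by simp
qed

text \<open>A Cauchy-type root bound. With \<open>u = 1/z\<close> the fibre equation is a polynomial
  in \<open>w\<close> with coefficients affine in \<open>u\<close>; isolating its top term bounds
  \<open>w\<close> times the top coefficient, uniformly for bounded \<open>u\<close>.\<close>

lemma ratF_section_growth_bound:
  assumes F: "F \<in> ratF"
  shows "\<exists>C. \<forall>u w. norm u \<le> R \<longrightarrow>
    u * (w * poly (cpoly (numP F)) w) = poly (cpoly (denQ F)) w \<longrightarrow>
    norm w * norm (of_real (coeff ([:0, 1:] * numP F) (ratF_degree F)) * u
         - of_real (coeff (denQ F) (ratF_degree F))) \<le> C"
proof -
  define a where "a k = complex_of_real (coeff ([:0, 1:] * numP F) k)" for k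
  define b where "b k = complex_of_real (coeff (denQ F) k)" for k
  define m where "m = ratF_degree F"
  define C where "C = (\<Sum>k\<le>m. R * norm (a k) + norm (b k))"
  have m: "m \<ge> 1" using ratF_degree_leading[OF F] by (simp add: m_def)
  have A: "w * poly (cpoly (numP F)) w = (\<Sum>k\<le>m. a k * w ^ k)" for w
  proof -
    have "degree (cpoly ([:0, 1:] * numP F)) \<le> m"
      by (simp add: m_def ratF_degree_def degree_map_poly del: mult_pCons_left)
    then have "poly (cpoly ([:0, 1:] * numP F)) w = (\<Sum>k\<le>m. a k * w ^ k)"
      unfolding poly_altdef a_def
      by (intro sum.mono_neutral_cong_left) (auto simp: coeff_map_poly coeff_eq_0 degree_map_poly simp del: mult_pCons_left)
    then show ?thesis unfolding cpoly_mult by simp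
  qed
  have B: "poly (cpoly (denQ F)) w = (\<Sum>k\<le>m. b k * w ^ k)" for w
  proof -
    have "degree (cpoly (denQ F)) \<le> m"
      by (simp add: m_def ratF_degree_def degree_map_poly)
    then show ?thesis
      unfolding poly_altdef b_def
      by (intro sum.mono_neutral_cong_left) (auto simp: coeff_map_poly coeff_eq_0 degree_map_poly)
  qed
  have "norm w * norm (a m * u - b m) \<le> C"
    if u: "norm u \<le> R" and eq: "u * (w * poly (cpoly (numP F)) w) = poly (cpoly (denQ F)) w" for u w
  proof -
    have R: "0 \<le> R" using u norm_ge_zero order_trans by blast
    have bnd: "norm (a k * u - b k) \<le> R * norm (a k) + norm (b k)" for k
    proof -
      have "norm (a k * u - b k) \<le> norm (a k) * norm u + norm (b k)"
        by (metis norm_mult norm_triangle_ineq4)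
      also have "\<dots> \<le> norm (a k) * R + norm (b k)" using u by (simp add: mult_left_mono)
      finally show ?thesis by (simp add: mult.commute)
    qed
    show ?thesis
    \<comment> \<open>For small \<open>w\<close> one summand of \<open>C\<close> suffices; for large
      \<open>w\<close> all lower powers are at most \<open>norm w ^ (m - 1)\<close>, which
      cancels.\<close>
    proof (cases "norm w \<le> 1")
      case True
      then have "norm w * norm (a m * u - b m) \<le> 1 * (R * norm (a m) + norm (b m))"
        by (intro mult_mono bnd) auto
      also have "\<dots> \<le> C"
        unfolding C_def using R by (simp add: member_le_sum[where f = "\<lambda>k. R * norm (a k) + norm (b k)"])
      finally show ?thesis .
    next
      case False
      have "(\<Sum>k\<le>m. (a k * u - b k) * w ^ k) = u * (\<Sum>k\<le>m. a k * w ^ k) - (\<Sum>k\<le>m. b k * w ^ k)"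
        by (simp add: sum_distrib_left sum_subtractf algebra_simps)
      also have "\<dots> = 0" using eq by (simp add: A B)
      finally have "(a m * u - b m) * w ^ m = - (\<Sum>k<m. (a k * u - b k) * w ^ k)"
        by (simp add: lessThan_Suc_atMost[symmetric] add_eq_0_iff2 add.commute)
      then have "norm (a m * u - b m) * norm w ^ m = norm (\<Sum>k<m. (a k * u - b k) * w ^ k)"
        by (metis norm_minus_cancel norm_mult norm_power)
      also have "\<dots> \<le> (\<Sum>k<m. (R * norm (a k) + norm (b k)) * norm w ^ (m - 1))"
      proof (intro sum_norm_le)
        fix k assume "k \<in> {..<m}"
        then have "norm w ^ k \<le> norm w ^ (m - 1)" using False by (intro power_increasing) auto
        then show "norm ((a k * u - b k) * w ^ k) \<le> (R * norm (a k) + norm (b k)) * norm w ^ (m - 1)"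
          unfolding norm_mult norm_power using R by (intro mult_mono bnd) auto
      qed
      also have "\<dots> \<le> C * norm w ^ (m - 1)"
        unfolding C_def sum_distrib_right using R by (intro sum_mono2) auto
      finally have "(norm w * norm (a m * u - b m)) * norm w ^ (m - 1) \<le> C * norm w ^ (m - 1)"
        using m by (cases m) (auto simp: mult_ac)
      moreover have "norm w ^ (m - 1) > 0" using False by (intro zero_less_power) linarith
      ultimately show ?thesis by simp
    qed
  qed
  then show ?thesis unfolding a_def b_def m_def by blast
qed

text \<open>Without critical points over the half-plane, \<open>F\<close> is locally injective
  there. Constant finite fibre size upgrades this to even covering: the inverse branches through the
  points of one fibre exhaust all nearby fibres.\<close>

lemma covering_space_ratF_val:
  assumes F: "F \<in> ratF_rr"
  shows "covering_space {w. poly (cpoly (denQ F)) w \<noteq> 0 \<and> Im (ratF_val F w) > 0}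
           (ratF_val F) {z. Im z > 0}"
proof -
  have F': "F \<in> ratF" using F by (simp add: ratF_rr_def)
  define f where "f = ratF_val F"
  define S where "S = {w. poly (cpoly (denQ F)) w \<noteq> 0}"
  define H where "H = {z :: complex. Im z > 0}"
  define C where "C = {w \<in> S. f w \<in> H}"
  define W where "W z = {w. poly (root_poly F z) w = 0}" for z
  have S: "open S" "f holomorphic_on S"
    using open_denQ_nz[of F] ratF_val_holomorphic[of F] by (auto simp: S_def f_def)
  have W: "w \<in> W z \<longleftrightarrow> w \<in> S \<and> f w = z" for w z
    by (simp add: W_def root_poly_eq_0_iff ratF_val_eq_iff[OF F'] S_def f_def)
  have W_fin: "finite (W z)" for z
    unfolding W_def by (rule poly_roots_finite[OF root_poly_nz[OF F']])
  have W_card: "card (W z) = ratF_degree F" if "z \<in> H" for z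
    unfolding W_def by (rule card_roots_root_poly[OF F]) (use that in \<open>simp add: H_def\<close>)
  have local_inj: "\<exists>e>0. ball w e \<subseteq> S \<and> inj_on f (ball w e)" if "w \<in> C" for w
  proof -
    have w: "w \<in> S" "f w \<in> H" using that by (auto simp: C_def)
    have "f w \<notin> critN F" using w F by (auto simp: ratF_rr_def H_def complex_is_Real_iff)
    then have "poly (cpoly (chiF F)) w \<noteq> 0"
      using w by (auto simp: critN_iff[OF F'] S_def f_def)
    moreover have "deriv f w = poly (cpoly (chiF F)) w / poly (cpoly (denQ F)) w ^ 2"
      unfolding f_def using w by (intro DERIV_imp_deriv ratF_val_has_field_derivative) (simp add: S_def)
    ultimately have "deriv f w \<noteq> 0" using w by (simp add: S_def)
    then show ?thesis
      using has_complex_derivative_locally_injective[OF S(2) w(1) S(1)] by metis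
  qed
  have "covering_space C f H"
  proof
    show "continuous_on C f"
      using holomorphic_on_imp_continuous_on[OF S(2)] by (rule continuous_on_subset) (auto simp: C_def)
    show "f ` C = H"
    proof (intro equalityI subsetI)
      fix z assume z: "z \<in> H"
      then have "W z \<noteq> {}" using W_card[OF z] ratF_degree_leading(2)[OF F'] by force
      then show "z \<in> f ` C" using z by (auto simp: W C_def)
    qed (auto simp: C_def)
  next
    fix z0 assume z0: "z0 \<in> H"
    have WC: "w \<in> C" if "w \<in> W z0" for w using that z0 by (auto simp: W C_def)
    \<comment> \<open>Radii of at most half the distance to the other fibre points make the balls
      pairwise disjoint.\<close>
    have "\<exists>e>0. ball w e \<subseteq> S \<and> inj_on f (ball w e) \<and> (\<forall>w'\<in>W z0. w' \<noteq> w \<longrightarrow> 2 * e \<le> dist w w')"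
      if w: "w \<in> W z0" for w
    proof -
      obtain e1 where e1: "e1 > 0" "ball w e1 \<subseteq> S" "inj_on f (ball w e1)"
        using local_inj[OF WC[OF w]] by blast
      obtain e2 where e2: "e2 > 0" "\<And>w'. w' \<in> W z0 \<Longrightarrow> w' \<noteq> w \<Longrightarrow> e2 \<le> dist w w'"
        using finite_set_avoid[OF W_fin, of z0 w] by blast
      have sub: "ball w (min e1 (e2 / 2)) \<subseteq> ball w e1" by auto
      show ?thesis
        using e1 e2 sub inj_on_subset[OF e1(3) sub]
        by (intro exI[of _ "min e1 (e2 / 2)"]) (fastforce simp: min_def)
    qed
    then obtain e where e: "\<And>w. w \<in> W z0 \<Longrightarrow> e w > 0"
      and eS: "\<And>w. w \<in> W z0 \<Longrightarrow> ball w (e w) \<subseteq> S"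
      and inj: "\<And>w. w \<in> W z0 \<Longrightarrow> inj_on f (ball w (e w))"
      and sep: "\<And>w w'. w \<in> W z0 \<Longrightarrow> w' \<in> W z0 \<Longrightarrow> w' \<noteq> w \<Longrightarrow> 2 * e w \<le> dist w w'"
      by metis
    define U where "U w = ball w (e w)" for w
    have disj: "U w \<inter> U w' = {}" if "w \<in> W z0" "w' \<in> W z0" "w \<noteq> w'" for w w'
    proof -
      have "e w + e w' \<le> dist w w'"
        using sep[of w w'] sep[of w' w] that by (simp add: dist_commute)
      then show ?thesis unfolding U_def by (rule disjoint_ballI)
    qed
    have U_hol: "f holomorphic_on U w" if "w \<in> W z0" for w
      using S(2) eS[OF that] unfolding U_def by (rule holomorphic_on_subset)
    \<comment> \<open>Every point of \<open>T\<close> has a preimage in each of the balls, so each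
      ball carries a full sheet over \<open>T\<close>.\<close>
    define T where "T = H \<inter> (\<Inter>w\<in>W z0. f ` U w)"
    have "open T"
      unfolding T_def H_def
    proof (intro open_Int open_INT open_halfspace_Im_gt W_fin ballI)
      fix w assume w: "w \<in> W z0"
      show "open (f ` U w)"
        using open_mapping_thm3[OF U_hol[OF w]] inj[OF w] by (simp add: U_def)
    qed
    have "z0 \<in> T"
    proof -
      have "z0 \<in> f ` U w" if "w \<in> W z0" for w
        using that e[OF that] by (intro image_eqI[of _ _ w]) (auto simp: W U_def)
      with z0 show ?thesis by (auto simp: T_def)
    qed
    define v where "v = (\<lambda>w. U w \<inter> f -` T) ` W z0"
    show "\<exists>T. z0 \<in> T \<and> openin (top_of_set H) T \<and>
             (\<exists>v. \<Union>v = C \<inter> f -` T \<and> (\<forall>u\<in>v. openin (top_of_set C) u) \<and>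
                  pairwise disjnt v \<and> (\<forall>u\<in>v. \<exists>q. homeomorphism u T f q))"
    proof (intro exI[of _ T] conjI exI[of _ v] ballI)
      show "z0 \<in> T" by fact
      show "openin (top_of_set H) T"
        using \<open>open T\<close> unfolding openin_open by (intro exI[of _ T]) (auto simp: T_def)
      show "\<Union>v = C \<inter> f -` T"
      proof (intro equalityI subsetI)
        fix w assume "w \<in> \<Union>v"
        then show "w \<in> C \<inter> f -` T"
          using eS by (force simp: v_def C_def U_def T_def)
      next
        fix w' assume w': "w' \<in> C \<inter> f -` T"
        then have T: "f w' \<in> T" "f w' \<in> H" "w' \<in> W (f w')" by (auto simp: C_def W)
        have "\<exists>x. x \<in> U w \<and> f x = f w'" if "w \<in> W z0" for w
          using T(1) that unfolding T_def by (metis IntD2 INT_D imageE)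
        then obtain h where h: "\<And>w. w \<in> W z0 \<Longrightarrow> h w \<in> U w \<and> f (h w) = f w'"
          by metis
        \<comment> \<open>The sheets already contain as many points over \<open>f w'\<close> as the degree allows.\<close>
        have "inj_on h (W z0)"
          using h disj by (intro inj_onI) (metis IntI empty_iff)
        then have "card (h ` W z0) = card (W (f w'))"
          by (simp add: card_image W_card z0 T(2))
        moreover have "h ` W z0 \<subseteq> W (f w')"
          using h eS by (fastforce simp: W U_def)
        ultimately have "h ` W z0 = W (f w')"
          by (intro card_subset_eq W_fin)
        then obtain w where "w \<in> W z0" "w' = h w" using T(3) by blast
        with h[of w] T(1) show "w' \<in> \<Union>v" by (auto simp: v_def)
      qed
      show "pairwise disjnt v"
        unfolding v_def using disj by (fastforce simp: pairwise_def disjnt_def)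
    next
      fix u assume "u \<in> v"
      then obtain w where w: "w \<in> W z0" "u = U w \<inter> f -` T" by (auto simp: v_def)
      have "open u"
        unfolding w(2)
        using holomorphic_on_imp_continuous_on[OF U_hol[OF w(1)]] \<open>open T\<close>
        by (intro continuous_open_preimage) (auto simp: U_def)
      moreover have "u \<subseteq> C" using w eS by (fastforce simp: C_def U_def T_def)
      ultimately show "openin (top_of_set C) u" by (auto simp: openin_open)
      obtain g where g: "g holomorphic_on f ` U w" "\<And>x. x \<in> U w \<Longrightarrow> g (f x) = x"
        using holomorphic_has_inverse[OF U_hol[OF w(1)]] inj[OF w(1)] by (metis U_def open_ball)
      have TU: "T \<subseteq> f ` U w" using w by (auto simp: T_def)
      show "\<exists>q. homeomorphism u T f q"
      proof (intro exI homeomorphismI)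
        show "continuous_on u f"
          using holomorphic_on_imp_continuous_on[OF U_hol[OF w(1)]]
          by (rule continuous_on_subset) (auto simp: w)
        show "continuous_on T g"
          using holomorphic_on_imp_continuous_on[OF g(1)] TU by (rule continuous_on_subset)
      qed (use g TU in \<open>auto simp: w subset_iff\<close>)
    qed
  qed
  then show ?thesis by (simp add: C_def S_def H_def f_def)
qed

text \<open>The section is the lift of the identity of the half-plane through the covering, started
  on the branch \<open>D\<close>; simple connectedness provides the lift.\<close>

lemma ratF_rr_section:
  assumes F: "F \<in> ratF_rr"
  obtains g r where "g holomorphic_on {z. Im z > 0}" "0 < r"
    "\<And>z. Im z > 0 \<Longrightarrow> poly (cpoly (denQ F)) (g z) \<noteq> 0 \<and> ratF_val F (g z) = z"
    "\<And>z. Im z > 0 \<Longrightarrow> norm z < r \<Longrightarrow> g z = eval_fps (fps_cplx (invD F)) z"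
proof -
  have F': "F \<in> ratF" using F by (simp add: ratF_rr_def)
  define D where "D = eval_fps (fps_cplx (invD F))"
  define f where "f = ratF_val F"
  define C where "C = {w. poly (cpoly (denQ F)) w \<noteq> 0 \<and> Im (f w) > 0}"
  define H where "H = {z :: complex. Im z > 0}"
  have cov: "covering_space C f H"
    unfolding C_def f_def H_def by (rule covering_space_ratF_val[OF F])
  obtain r where r: "0 < r" "ereal r \<le> fps_conv_radius (fps_cplx (invD F))"
    and D: "\<And>z. norm z < r \<Longrightarrow> poly (cpoly (denQ F)) (D z) \<noteq> 0 \<and> f (D z) = z"
    unfolding D_def f_def by (rule local_inverse_at_0[OF F']) blast
  \<comment> \<open>A base point of the half-plane inside the disc where \<open>D\<close> inverts
    \<open>F\<close>.\<close>
  define z1 where "z1 = \<i> * of_real (r / 2)"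
  have z1: "z1 \<in> H" "norm z1 < r" using r by (auto simp: z1_def H_def norm_mult)
  have convex: "convex H" unfolding H_def by (rule convex_halfspace_Im_gt)
  have D_C: "D z \<in> C" if "z \<in> H" "norm z < r" for z using D[OF that(2)] that by (auto simp: C_def H_def)
  obtain g where g: "continuous_on H g" "g \<in> H \<rightarrow> C" "g z1 = D z1" "\<And>y. y \<in> H \<Longrightarrow> f (g y) = y"
  proof (rule covering_space_lift_strong[OF cov D_C[OF z1] z1(1), of "\<lambda>z. z"])
    show "simply_connected H" using convex by (rule convex_imp_simply_connected)
    show "locally path_connected H" using convex by (rule convex_imp_locally_path_connected)
  qed (use D z1 in auto)
  show ?thesis
  proof (rule that[OF _ r(1)])
    show "g holomorphic_on {z. Im z > 0}"
    proof (rule covering_space_lift_is_holomorphic[OF cov, of "\<lambda>z. z", folded H_def])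
      have sub: "C \<subseteq> {w. poly (cpoly (denQ F)) w \<noteq> 0}" by (auto simp: C_def)
      show "f holomorphic_on C"
        unfolding f_def using ratF_val_holomorphic[of F] sub by (rule holomorphic_on_subset)
      have "open ({w. poly (cpoly (denQ F)) w \<noteq> 0} \<inter> f -` H)"
        unfolding f_def H_def
        by (intro continuous_open_preimage holomorphic_on_imp_continuous_on ratF_val_holomorphic
            open_denQ_nz open_halfspace_Im_gt)
      also have "{w. poly (cpoly (denQ F)) w \<noteq> 0} \<inter> f -` H = C" by (auto simp: C_def H_def)
      finally show "open C" .
    qed (use g in \<open>auto simp: H_def\<close>)
    show "poly (cpoly (denQ F)) (g z) \<noteq> 0 \<and> ratF_val F (g z) = z" if "Im z > 0" for z
      using that g(2,4) by (auto simp: H_def C_def f_def)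
    fix z :: complex assume z: "Im z > 0" "norm z < r"
    \<comment> \<open>On this convex half-disc \<open>g\<close> and \<open>D\<close> both lift the
      identity and agree at \<open>z1\<close>, so uniqueness of lifts identifies them.\<close>
    define V where "V = H \<inter> ball 0 r"
    have "g z = D z"
    proof (rule covering_space_lift_unique[where a = z1 and x = z and T = V and f = "\<lambda>z. z" and p = f and c = C and S = H])
      show "continuous_on V g" using g(1) by (rule continuous_on_subset) (auto simp: V_def)
      show "continuous_on V D"
        unfolding D_def
      proof (intro continuous_on_eval_fps' continuous_intros subsetI)
        fix x assume "x \<in> (\<lambda>x. x) ` V"
        then have "ereal (norm x) < ereal r" by (simp add: V_def)
        with r(2) show "x \<in> eball 0 (fps_conv_radius (fps_cplx (invD F)))"
          unfolding in_eball_iff by (metis diff_0_right less_le_trans dist_0_norm)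
      qed
      show "connected V"
        unfolding V_def by (intro convex_connected convex_Int convex convex_ball)
    qed (use z z1 g D D_C cov in \<open>auto simp: V_def H_def\<close>)
    then show "g z = eval_fps (fps_cplx (invD F)) z" by (simp add: D_def)
  qed
qed

section \<open>Holomorphic sections over the half-plane yield distributions\<close>

text \<open>A real value of \<open>g\<close> would be sent by \<open>F\<close> to a real number, not
  to \<open>z\<close>. So \<open>Im g\<close> has no zero on the connected half-plane, and its sign
  is read off near \<open>0\<close>, where \<open>D(z)\<close> behaves like
  \<open>z\<close>.\<close>

lemma Im_section_pos:
  assumes F: "F \<in> ratF" and hol: "g holomorphic_on {z. Im z > 0}" and r: "0 < r"
    and sec: "\<And>z. Im z > 0 \<Longrightarrow> ratF_val F (g z) = z"
    and ser: "\<And>z. Im z > 0 \<Longrightarrow> norm z < r \<Longrightarrow> g z = eval_fps (fps_cplx (invD F)) z"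
    and z: "Im z > 0"
  shows "Im (g z) > 0"
proof -
  define D where "D = eval_fps (fps_cplx (invD F))"
  have D0: "D 0 = 0" using invD_props[OF F] by (simp add: D_def eval_fps_at_0)
  have "(D has_field_derivative eval_fps (fps_deriv (fps_cplx (invD F))) 0) (at 0)"
    unfolding D_def using fps_conv_radius_invD_pos[OF F]
    by (intro has_field_derivative_eval_fps) (simp add: zero_ereal_def)
  then have "(D has_field_derivative 1) (at 0)"
    using invD_props(3)[OF F] by (simp add: eval_fps_at_0 sF_def)
  then have "((\<lambda>h. D h / h) \<longlongrightarrow> 1) (at 0)"
    by (simp add: has_field_derivative_iff D0)
  then have "((\<lambda>h. Re (D h / h)) \<longlongrightarrow> Re 1) (at 0)" by (rule tendsto_Re)
  then have "eventually (\<lambda>h. Re (D h / h) > 0) (at 0)" by (rule order_tendstoD) simp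
  then obtain s where s: "s > 0" "\<And>h. h \<noteq> 0 \<Longrightarrow> norm h < s \<Longrightarrow> Re (D h / h) > 0"
    by (auto simp: eventually_at)
  define y where "y = min r s / 2"
  have y: "y > 0" "y < r" "y < s" using r s by (auto simp: y_def min_def)
  \<comment> \<open>Multiplied by \<open>y\<close>, this real part is the imaginary part of
    \<open>D\<close> at the point \<open>i y\<close>.\<close>
  have "Re (D (\<i> * of_real y) / (\<i> * of_real y)) > 0"
    using y by (intro s(2)) (auto simp: norm_mult)
  then have "Im (D (\<i> * of_real y)) > 0"
    using y by (simp add: Re_divide zero_less_divide_iff power2_eq_square zero_less_mult_iff)
  then have pos: "Im (g (\<i> * of_real y)) > 0"
    using ser[of "\<i> * of_real y"] y by (simp add: norm_mult D_def)
  have nz: "Im (g z) \<noteq> 0" if "Im z > 0" for z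
  proof
    assume "Im (g z) = 0"
    then have "ratF_val F (g z) \<in> \<real>" by (metis complex_is_Real_iff Reals_cases ratF_val_of_real)
    with sec[OF that] that show False by (simp add: complex_is_Real_iff)
  qed
  have "connected ((\<lambda>z. Im (g z)) ` {z. Im z > 0})"
    by (intro connected_continuous_image convex_connected convex_halfspace_Im_gt continuous_intros
        holomorphic_on_imp_continuous_on hol)
  \<comment> \<open>If \<open>Im (g z) \<le> 0\<close>, this interval would contain
    \<open>0\<close>, which is not a value of \<open>Im g\<close>.\<close>
  then have "{Im (g z)..Im (g (\<i> * of_real y))} \<subseteq> (\<lambda>z. Im (g z)) ` {z. Im z > 0}"
    using z y by (intro connected_contains_Icc) auto
  moreover have "0 \<notin> (\<lambda>z. Im (g z)) ` {z. Im z > 0}" using nz by force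
  ultimately have "0 \<notin> {Im (g z)..Im (g (\<i> * of_real y))}" by blast
  then show ?thesis using pos by simp
qed

text \<open>Inversion carries the section to a Pick function on the lower half-plane with expansion
  \<open>D(1/u)\<close> at infinity. The two leading coefficients of \<open>F\<close> supply the
  linear factor that controls its growth.\<close>

lemma section_imp_ratF_dist:
  assumes F: "F \<in> ratF" and hol: "g holomorphic_on {z. Im z > 0}" and r: "0 < r"
    and sec: "\<And>z. Im z > 0 \<Longrightarrow> poly (cpoly (denQ F)) (g z) \<noteq> 0 \<and> ratF_val F (g z) = z"
    and ser: "\<And>z. Im z > 0 \<Longrightarrow> norm z < r \<Longrightarrow> g z = eval_fps (fps_cplx (invD F)) z"
  shows "F \<in> ratF_dist"
proof -
  define d where "d = fps_cplx (invD F)"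
  obtain r0 where r0: "0 < r0" "ereal r0 \<le> fps_conv_radius d"
    unfolding d_def using ereal_dense2[OF fps_conv_radius_invD_pos[OF F]]
    by (auto simp: zero_ereal_def intro: less_imp_le)
  have Im_inverse: "Im (inverse u) > 0" if "Im u < 0" for u
  proof -
    have "0 < (Re u)\<^sup>2 + (Im u)\<^sup>2" using that by (simp add: sum_power2_gt_zero_iff)
    with that show ?thesis by (simp add: divide_neg_pos)
  qed
  have "moment_sequence (\<lambda>n. Re (fps_nth d (Suc n)))"
  proof (rule moment_sequence_if_Pick)
    show "(\<lambda>u. g (inverse u)) holomorphic_on {u. Im u < 0}"
    proof (rule holomorphic_on_compose_gen[of inverse _ g "{z. Im z > 0}", unfolded o_def])
      show "inverse holomorphic_on {u. Im u < 0}" by (intro holomorphic_intros) auto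
      show "inverse ` {u. Im u < 0} \<subseteq> {z. 0 < Im z}" using Im_inverse by blast
    qed (rule hol)
    show "0 \<le> Im (g (inverse u))" if "Im u < 0" for u
      using Im_section_pos[OF F hol r _ ser Im_inverse[OF that]] sec by force
    show "0 < min r r0" "ereal (min r r0) \<le> fps_conv_radius d"
      using r r0 by (auto simp: min_def intro: order_trans[of _ "ereal r0"])
    show "fps_nth d n \<in> \<real>" for n by (simp add: d_def)
    show "fps_nth d 0 = 0" "fps_nth d 1 = 1"
      using invD_props[OF F] by (simp_all add: d_def sF_def)
    show "g (inverse u) = eval_fps d (inverse u)" if "Im u < 0" "norm (inverse u) < min r r0" for u
      using ser[OF Im_inverse[OF that(1)]] that by (simp add: d_def)
    show "coeff ([:0, 1:] * numP F) (ratF_degree F) \<noteq> 0 \<or> coeff (denQ F) (ratF_degree F) \<noteq> 0"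
      by (rule ratF_degree_leading[OF F])
    fix R
    obtain C where C: "\<And>u w. norm u \<le> R \<Longrightarrow> u * (w * poly (cpoly (numP F)) w) = poly (cpoly (denQ F)) w \<Longrightarrow>
      norm w * norm (of_real (coeff ([:0, 1:] * numP F) (ratF_degree F)) * u
         - of_real (coeff (denQ F) (ratF_degree F))) \<le> C"
      using ratF_section_growth_bound[OF F, of R] by blast
    show "\<exists>C. \<forall>u. Im u < 0 \<longrightarrow> norm u \<le> R \<longrightarrow> norm (g (inverse u)) *
        norm (of_real (coeff ([:0, 1:] * numP F) (ratF_degree F)) * u
         - of_real (coeff (denQ F) (ratF_degree F))) \<le> C"
    proof (intro exI allI impI)
      fix u :: complex assume u: "Im u < 0" "norm u \<le> R"
      then have "u \<noteq> 0" by auto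
      note pos = Im_inverse[OF u(1)]
      have "g (inverse u) * poly (cpoly (numP F)) (g (inverse u))
          = inverse u * poly (cpoly (denQ F)) (g (inverse u))"
        using sec[OF pos] ratF_val_eq_iff[OF F] by blast
      then have "u * (g (inverse u) * poly (cpoly (numP F)) (g (inverse u)))
          = poly (cpoly (denQ F)) (g (inverse u))"
        using \<open>u \<noteq> 0\<close> by (metis mult.assoc mult.left_neutral right_inverse)
      then show "norm (g (inverse u)) *
        norm (of_real (coeff ([:0, 1:] * numP F) (ratF_degree F)) * u
         - of_real (coeff (denQ F) (ratF_degree F))) \<le> C"
        by (rule C[OF u(2)])
    qed
  qed
  moreover have "(\<lambda>n. Re (fps_nth d (Suc n))) = sF F"
    by (simp add: d_def sF_def[abs_def])
  ultimately show ?thesis using F by (simp add: ratF_dist_def)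
qed

text \<open>Intended for explicit sections: near \<open>0\<close> the cleared equation has only one
  small root, so tending to \<open>0\<close> already identifies the section with the branch
  \<open>D\<close>.\<close>

lemma section_tendsto_imp_ratF_dist:
  assumes F: "F \<in> ratF" and hol: "g holomorphic_on {z. Im z > 0}"
    and sec: "\<And>z. Im z > 0 \<Longrightarrow> poly (cpoly (denQ F)) (g z) \<noteq> 0 \<and> ratF_val F (g z) = z"
    and lim: "(g \<longlongrightarrow> 0) (at 0 within {z. Im z > 0})"
  shows "F \<in> ratF_dist"
proof -
  obtain r e where r: "0 < r" "0 < e" and uniq: "\<And>w z. norm w < e \<Longrightarrow> norm z < r \<Longrightarrow>
      w * poly (cpoly (numP F)) w = z * poly (cpoly (denQ F)) w \<Longrightarrow>
      w = eval_fps (fps_cplx (invD F)) z"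
    by (rule local_inverse_at_0[OF F]) (rule that)
  have "eventually (\<lambda>z. dist (g z) 0 < e) (at 0 within {z. Im z > 0})"
    using tendstoD[OF lim r(2)] .
  then obtain s where s: "s > 0" "\<And>z. Im z > 0 \<Longrightarrow> z \<noteq> 0 \<Longrightarrow> norm z < s \<Longrightarrow> norm (g z) < e"
    by (auto simp: eventually_at)
  show ?thesis
  proof (rule section_imp_ratF_dist[OF F hol _ sec])
    show "0 < min r s" using r s by simp
    show "g z = eval_fps (fps_cplx (invD F)) z" if "Im z > 0" "norm z < min r s" for z
    proof (rule uniq)
      have "z \<noteq> 0" using that by auto
      then show "norm (g z) < e" using that s(2) by simp
    qed (use that sec[OF that(1)] ratF_val_eq_iff[OF F, of "g z" z] in auto)
  qed
qed

section \<open>Strictness\<close>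

lemma represents_ratF:
  assumes "represents F P Q"
  shows "F \<in> ratF" "numP F = P" "denQ F = Q"
  using assms numP_eq denQ_eq by (auto simp: ratF_def)

lemma not_ratF_rr_subset_ratF_rr0: "\<exists>F. F \<in> ratF_rr \<and> F \<notin> ratF_rr0"
proof -
  \<comment> \<open>\<open>F = (q\<^sup>2 - 1) / 2\<close> with \<open>q = w\<^sup>2 + w + 1\<close>, so both non-real critical points have value \<open>-1/2\<close>.\<close>
  define P where "P = [:1, 3/2, 1, 1/2 :: real:]"
  define F where "F = Fract ([:0, 1:] * P) 1"
  have "represents F P 1" by (simp add: represents_def F_def P_def)
  note F = represents_ratF[OF this]
  have p: "poly (cpoly P) w = 1 + 3/2 * w + w ^ 2 + w ^ 3 / 2"
    and p': "poly (cpoly (pderiv P)) w = 3/2 + 2 * w + 3/2 * w ^ 2" for w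
    by (simp_all add: P_def map_poly_pCons pderiv_pCons power2_eq_square power3_eq_cube algebra_simps)
  have chi: "poly (cpoly (chiF F)) w = (w\<^sup>2 + w + 1) * (2 * w + 1)" for w
  proof -
    have "poly (cpoly (chiF F)) w = poly (cpoly P) w + w * poly (cpoly (pderiv P)) w"
      by (simp add: chiF_def F cpoly_add cpoly_mult map_poly_pCons)
    then show ?thesis
      unfolding p p' by (simp add: algebra_simps power2_eq_square power3_eq_cube)
  qed
  have val: "ratF_val F w = ((w\<^sup>2 + w + 1)\<^sup>2 - 1) / 2" for w
    unfolding ratF_val_def F p
    by (simp add: algebra_simps power2_eq_square power3_eq_cube add_divide_distrib diff_divide_distrib)
  have "z \<in> \<real>" if "z \<in> critN F" for z
  proof -
    from that obtain w where w: "ratF_val F w = z" "(w\<^sup>2 + w + 1) * (2 * w + 1) = 0"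
      using critN_iff[OF F(1)] chi by metis
    from w(2) consider "w\<^sup>2 + w + 1 = 0" | "2 * w + 1 = 0"
      unfolding mult_eq_0_iff by blast
    then show ?thesis
    proof cases
      case 1
      then have "z = of_real (- 1 / 2)" using w by (simp add: val)
      then show ?thesis by (metis Reals_of_real)
    next
      case 2
      then have "w = of_real (- 1 / 2)" by (simp add: field_simps add_eq_0_iff)
      then show ?thesis using w ratF_val_of_real by metis
    qed
  qed
  then have "F \<in> ratF_rr" using F by (auto simp: ratF_rr_def)
  \<comment> \<open>A primitive cube root of unity, hence a non-real root of
    \<open>q\<close>.\<close>
  moreover define w where "w = Complex (- 1 / 2) (sqrt 3 / 2)"
  have "poly (cpoly (chiF F)) w = 0" "w \<notin> \<real>"
    by (auto simp: chi w_def complex_eq_iff power2_eq_square complex_is_Real_iff)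
  then have "F \<notin> ratF_rr0" by (auto simp: ratF_rr0_def)
  ultimately show ?thesis by blast
qed

text \<open>For \<open>F = w + w^3\<close> the inverse starts with \<open>z - z^3\<close>, so the
  second moment would have to be \<open>-1\<close>.\<close>

lemma not_ratF_subset_ratF_dist: "\<exists>F. F \<in> ratF \<and> F \<notin> ratF_dist"
proof -
  define P where "P = [:1, 0, 1 :: real:]"
  define F where "F = Fract ([:0, 1:] * P) 1"
  have "represents F P 1" by (simp add: represents_def F_def P_def)
  note F = represents_ratF[OF this]
  define E where "E = Abs_fps (sF F)"
  have E: "invD F = fps_X * E"
    using invD_props(2)[OF F(1)]
    by (intro fps_ext) (auto simp: E_def sF_def gr0_conv_Suc)
  have D0: "fps_nth (invD F) 0 = 0" using invD_props[OF F(1)] by simp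
  have "fps_of_poly ([:0, 1:] * P) = fps_X * (1 + fps_X * fps_X)"
    by (simp add: P_def fps_of_poly_pCons mult.commute)
  with poly_compose_invD[OF F(1)]
  have "(fps_X * (1 + fps_X * fps_X)) oo invD F = fps_X * (1 oo invD F)"
    by (simp only: F fps_of_poly_1)
  then have "invD F * (1 + invD F * invD F) = fps_X"
    by (simp add: fps_compose_mult_distrib[OF D0] fps_compose_add_distrib D0)
  \<comment> \<open>Writing \<open>D = z E\<close> turns \<open>D + D^3 = z\<close> into
    \<open>E + z^2 E^3 = 1\<close>, whose coefficient at \<open>z^2\<close> determines the second
    moment.\<close>
  then have "fps_X * (E + fps_X ^ 2 * (E * E * E)) = fps_X * 1"
    by (simp add: E algebra_simps power2_eq_square)
  then have "E + fps_X ^ 2 * (E * E * E) = 1" by simp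
  then have "fps_nth (E + fps_X ^ 2 * (E * E * E)) 2 = 0" by simp
  then have "sF F 2 + (fps_nth E 0) ^ 3 = 0"
    by (simp add: fps_X_power_mult_nth E_def power3_eq_cube)
  then have "sF F 2 = - 1" using invD_props(3)[OF F(1)] by (simp add: E_def)
  moreover have "sF F 2 \<ge> 0" if mom: "moment_sequence (sF F)"
  proof -
    obtain M :: "real measure" where "sF F 2 = (\<integral>x. x ^ 2 \<partial>M)"
      using mom unfolding moment_sequence_def by blast
    then show ?thesis by (simp add: integral_nonneg_AE)
  qed
  ultimately have "F \<notin> ratF_dist" by (auto simp: ratF_dist_def)
  with F show ?thesis by blast
qed

section \<open>A distribution with non-real critical values\<close>

lemma Re_csqrt_pos:
  assumes "z \<notin> \<real>\<^sub>\<le>\<^sub>0"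
  shows "Re (csqrt z) > 0"
proof -
  have "Re (csqrt z) \<noteq> 0"
  proof
    assume "Re (csqrt z) = 0"
    then have "(csqrt z)\<^sup>2 \<in> \<real>\<^sub>\<le>\<^sub>0" 
      by (auto simp: complex_nonpos_Reals_iff power2_eq_square simp del: csqrt.sel power2_csqrt)
    with assms show False by simp
  qed
  with Re_csqrt[of z] show ?thesis by linarith
qed

lemma one_plus_csqrt_nz: "1 + csqrt z \<noteq> 0"
  using Re_csqrt[of z] by (auto simp: complex_eq_iff simp del: csqrt.sel)

lemma not_ratF_dist_subset_ratF_rr: "\<exists>F. F \<in> ratF_dist \<and> F \<notin> ratF_rr"
proof -
  \<comment> \<open>With \<open>F\<^sub>2 = w / P\<close>, the composition is
    \<open>w P / (P^2 + w^2)\<close>, which explains \<open>Q\<close>.\<close>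
  define P where "P = [:1, 0, - 1 / 16 :: real:]"
  define Q where "Q = P * P + [:0, 0, 1:]"
  define F where "F = Fract ([:0, 1:] * P) Q"
  have "coprime P Q"
  proof (rule coprimeI)
    fix c assume "c dvd P" "c dvd Q"
    then have "c dvd Q - P * P + smult 16 P"
      by (meson dvd_add dvd_diff dvd_mult2 dvd_smult)
    also have "Q - P * P + smult 16 P = [:16:]" by (simp add: Q_def P_def)
    also have "[:16 :: real:] dvd 1" by (rule dvdI[of _ _ "[:1 / 16:]"]) simp
    finally show "c dvd 1" .
  qed
  then have "represents F P Q" by (simp add: represents_def F_def P_def Q_def)
  note F = represents_ratF[OF this]
  have p: "poly (cpoly P) w = 1 - w\<^sup>2 / 16" for w
    by (simp add: P_def map_poly_pCons power2_eq_square)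
  have p': "poly (cpoly (pderiv P)) w = - w / 8" for w
    by (simp add: P_def map_poly_pCons pderiv_pCons)
  have q: "poly (cpoly Q) w = (1 - w\<^sup>2 / 16)\<^sup>2 + w\<^sup>2" for w
    unfolding Q_def cpoly_add cpoly_mult by (simp add: map_poly_pCons p power2_eq_square)
  have q': "poly (cpoly (pderiv Q)) w = 2 * (1 - w\<^sup>2 / 16) * (- w / 8) + 2 * w" for w
    unfolding Q_def cpoly_pderiv cpoly_add cpoly_mult pderiv_add pderiv_mult
    unfolding cpoly_pderiv[symmetric]
    by (simp add: map_poly_pCons p p' pderiv_pCons)
  have val: "ratF_val F w = w * (1 - w\<^sup>2 / 16) / ((1 - w\<^sup>2 / 16)\<^sup>2 + w\<^sup>2)" for w
    by (simp add: ratF_val_def F p q)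
  \<comment> \<open>The derivative of \<open>w / P\<close> vanishes at \<open>4i\<close>, where
    \<open>w / P\<close> equals \<open>2i\<close>; the critical value of \<open>F\<close> there is
    \<open>-2i/3\<close>.\<close>
  have "poly (cpoly (chiF F)) (4 * \<i>) = 0"
    unfolding chiF_def F cpoly_diff cpoly_mult cpoly_add poly_diff poly_mult poly_add p q p' q'
    by (simp add: map_poly_pCons power2_eq_square)
  then have "ratF_val F (4 * \<i>) \<in> critN F"
    unfolding critN_iff[OF F(1)] by (intro exI[of _ "4 * \<i>"]) (simp add: F q power2_eq_square)
  moreover have "ratF_val F (4 * \<i>) \<notin> \<real>"
    by (simp add: val power2_eq_square complex_is_Real_iff)
  ultimately have "F \<notin> ratF_rr" by (auto simp: ratF_rr_def)
  \<comment> \<open>\<open>t\<close> inverts \<open>F\<^sub>1\<close>, and \<open>g\<close> is the inverse of \<open>F\<^sub>2\<close> applied to \<open>t\<close>.\<close>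
  moreover define s t where "s z = csqrt (1 - 4 * z\<^sup>2)" and "t z = 2 * z / (1 + s z)" for z
  define g where "g z = 2 * t z / (1 + csqrt (1 + (t z)\<^sup>2 / 4))" for z
  have "F \<in> ratF_dist"
  proof (rule section_tendsto_imp_ratF_dist[OF F(1)])
    have dom1: "1 - 4 * z\<^sup>2 \<notin> \<real>\<^sub>\<le>\<^sub>0" if "Im z > 0" for z
    proof
      assume "1 - 4 * z\<^sup>2 \<in> \<real>\<^sub>\<le>\<^sub>0"
      then have "Re z * Im z = 0" "1 \<le> 4 * ((Re z)\<^sup>2 - (Im z)\<^sup>2)"
        by (auto simp: complex_nonpos_Reals_iff power2_eq_square)
      moreover from this that have "Re z = 0" by simp
      moreover have "0 \<le> (Im z)\<^sup>2" by simp
      ultimately show False by simp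
    qed
    \<comment> \<open>As \<open>s^2 = 1 - 4 z^2\<close>, the square of \<open>t\<close> is a Cayley
      transform of \<open>s\<close>, so \<open>Re s > 0\<close> places \<open>t\<close> in the unit
      disc.\<close>
    have t_sq: "(t z)\<^sup>2 = (1 - s z) / (1 + s z)" for z
    proof -
      have "4 * z\<^sup>2 = (1 - s z) * (1 + s z)"
        by (simp add: s_def algebra_simps flip: power2_eq_square)
      then have "(t z)\<^sup>2 = (1 - s z) * (1 + s z) / (1 + s z)\<^sup>2"
        by (simp add: t_def power_divide power_mult_distrib)
      then show ?thesis using one_plus_csqrt_nz by (simp add: s_def power2_eq_square)
    qed
    have t_lt: "norm ((t z)\<^sup>2) < 1" if "Im z > 0" for z
    proof -
      have "Re (s z) > 0" unfolding s_def by (rule Re_csqrt_pos[OF dom1[OF that]])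
      then have "(norm (1 - s z))\<^sup>2 < (norm (1 + s z))\<^sup>2"
        unfolding cmod_power2 by (simp add: power2_eq_square algebra_simps)
      then have "norm (1 - s z) < norm (1 + s z)" by (rule power_less_imp_less_base) simp
      then show ?thesis by (simp add: t_sq norm_divide divide_less_eq)
    qed
    \<comment> \<open>In the unit disc \<open>t\<close> stays away from the branch points
      \<open>2i\<close> and \<open>-2i\<close> of the second square root.\<close>
    have dom2: "1 + (t z)\<^sup>2 / 4 \<notin> \<real>\<^sub>\<le>\<^sub>0" if "Im z > 0" for z
    proof -
      have "Re ((t z)\<^sup>2) > -1"
        using abs_Re_le_cmod[of "(t z)\<^sup>2"] t_lt[OF that] by linarith
      then have "Re (1 + (t z)\<^sup>2 / 4) > 0" by simp
      then show ?thesis by (auto simp: complex_nonpos_Reals_iff)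
    qed
    show "g holomorphic_on {z. Im z > 0}"
    proof -
      have s: "s holomorphic_on {z. Im z > 0}"
        unfolding s_def by (intro holomorphic_on_csqrt' holomorphic_intros) (use dom1 in auto)
      then have t: "t holomorphic_on {z. Im z > 0}"
        unfolding t_def by (intro holomorphic_on_divide holomorphic_intros s) (simp_all add: s_def one_plus_csqrt_nz)
      have u: "(\<lambda>z. csqrt (1 + (t z)\<^sup>2 / 4)) holomorphic_on {z. Im z > 0}"
        by (intro holomorphic_on_csqrt' holomorphic_intros t) (use dom2 in auto)
      show ?thesis
        unfolding g_def
        by (intro holomorphic_on_divide holomorphic_on_add holomorphic_on_mult holomorphic_on_const t u) (simp_all add: one_plus_csqrt_nz)
    qed
    show "poly (cpoly (denQ F)) (g z) \<noteq> 0 \<and> ratF_val F (g z) = z" if z: "Im z > 0" for z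
    proof -
      \<comment> \<open>The point \<open>2 t / (1 + s2)\<close> is the root of
        \<open>w = t (1 - w^2 / 16)\<close> that vanishes with \<open>t\<close>, rationalised to
        avoid dividing by \<open>t\<close>.\<close>
      define s2 where "s2 = csqrt (1 + (t z)\<^sup>2 / 4)"
      have nz: "1 + s z \<noteq> 0" "1 + s2 \<noteq> 0"
        unfolding s_def s2_def by (rule one_plus_csqrt_nz)+
      have g: "g z = 2 * t z / (1 + s2)" by (simp add: g_def s2_def)
      have "(t z)\<^sup>2 = 4 * (s2 - 1) * (1 + s2)"
        by (simp add: s2_def algebra_simps flip: power2_eq_square)
      then have "(g z)\<^sup>2 = 16 * (s2 - 1) * (1 + s2) / (1 + s2)\<^sup>2"
        by (simp add: g power_divide power_mult_distrib)
      then have g_sq: "(g z)\<^sup>2 = 16 * c" if "c = (s2 - 1) / (1 + s2)" for c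
        using nz that by (simp add: power2_eq_square)
      have "1 - (g z)\<^sup>2 / 16 = 1 - (s2 - 1) / (1 + s2)"
        unfolding g_sq[OF refl] by (rule arg_cong[of _ _ "\<lambda>x. 1 - x"]) (rule nonzero_mult_div_cancel_left, simp)
      also have "\<dots> = 2 / (1 + s2)" using nz by (simp add: field_simps)
      finally have P: "1 - (g z)\<^sup>2 / 16 = 2 / (1 + s2)" .
      have gt: "g z = t z * (2 / (1 + s2))" by (simp add: g)
      have "1 + (t z)\<^sup>2 = 2 / (1 + s z)" using nz by (simp add: t_sq field_simps)
      then have Q: "(1 - (g z)\<^sup>2 / 16)\<^sup>2 + (g z)\<^sup>2 = (2 / (1 + s2))\<^sup>2 * (2 / (1 + s z))"
        by (metis P gt power_mult_distrib distrib_left mult.commute mult.right_neutral)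
      have "ratF_val F (g z) = (t z * (2 / (1 + s2))\<^sup>2) / ((2 / (1 + s2))\<^sup>2 * (2 / (1 + s z)))"
        unfolding val unfolding Q unfolding P unfolding gt by (simp add: power2_eq_square)
      also have "\<dots> = t z * (1 + s z) / 2" using nz by simp
      also have "\<dots> = z" using nz by (simp add: t_def)
      finally show ?thesis using Q nz by (simp add: F q)
    qed
    \<comment> \<open>At \<open>0\<close> both square roots are taken at \<open>1\<close>, off the
      branch cut, so \<open>g\<close> is continuous in a full neighbourhood sense there.\<close>
    have "isCont g 0"
    proof -
      have t0: "t 0 = 0" by (simp add: t_def)
      have "isCont s 0"
        unfolding s_def by (rule isCont_o2[OF _ continuous_at_csqrt]) (auto intro!: continuous_intros)
      then have t: "isCont t 0"
        unfolding t_def using one_plus_csqrt_nz by (intro continuous_intros) (auto simp: s_def)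
      have "isCont (\<lambda>z. csqrt (1 + (t z)\<^sup>2 / 4)) 0"
        by (rule isCont_o2[OF _ continuous_at_csqrt]) (auto intro!: continuous_intros t simp: t0)
      then show ?thesis
        unfolding g_def using one_plus_csqrt_nz t by (intro continuous_intros) auto
    qed
    moreover have "g 0 = 0" by (simp add: g_def t_def)
    ultimately have "(g \<longlongrightarrow> 0) (at 0)" unfolding isCont_def by simp
    then show "(g \<longlongrightarrow> 0) (at 0 within {z. Im z > 0})"
      by (rule tendsto_within_subset) simp
  qed
  ultimately show ?thesis by blast
qed

theorem mainTheorem1:
  shows "ratF_rr0 \<subset> ratF_rr \<and> ratF_rr \<subset> ratF_dist \<and> ratF_dist \<subset> ratF"
proof -
  have "ratF_rr \<subseteq> ratF_dist"
  proof
    fix F assume F: "F \<in> ratF_rr"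
    then have F': "F \<in> ratF" by (simp add: ratF_rr_def)
    show "F \<in> ratF_dist"
    proof (rule ratF_rr_section[OF F])
      fix g r
      assume "g holomorphic_on {z. Im z > 0}" "0 < r"
        "\<And>z. Im z > 0 \<Longrightarrow> poly (cpoly (denQ F)) (g z) \<noteq> 0 \<and> ratF_val F (g z) = z"
        "\<And>z. Im z > 0 \<Longrightarrow> norm z < r \<Longrightarrow> g z = eval_fps (fps_cplx (invD F)) z"
      then show ?thesis by (rule section_imp_ratF_dist[OF F'])
    qed
  qed
  moreover have "ratF_dist \<subseteq> ratF" by (auto simp: ratF_dist_def)
  ultimately show ?thesis
    using ratF_rr0_subset_ratF_rr not_ratF_rr_subset_ratF_rr0 not_ratF_dist_subset_ratF_rr
      not_ratF_subset_ratF_dist by blast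
qed

end
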